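(* For every integer $n\ge 6$, $$ex_{\mathcal{OP}}(n,S_{2,2})=\begin{cases}\left\lfloor\frac{3(n-1)}{2}\right\rfloor, & \text{if } n\neq 10,\\ 14, & \text{if } n=10.\end{cases}$$
   Context: All graphs are finite, simple and undirected. For integers $q\ge p\ge 1$, the double star $S_{p,q}$ is the graph obtained from an edge $xy$ by joining $x$ to $p$ new vertices and $y$ to $q$ further new vertices. A graph is $H$-free if it contains no subgraph isomorphic to $H$. A graph is outerplanar if it has a planar embedding with all vertices on the boundary of the outer face. $ex_{\mathcal{OP}}(n,H)$ denotes the maximum number of edges of an $H$-free outerplanar graph on $n$ vertices (not necessarily connected). *)

theory Defs
  imports "HOL-Analysis.Analysis"
begin

record 'a graph =
  verts :: "'a set"
  edges :: "'a set set"

definition simple_graph :: "'a graph \<Rightarrow> bool" where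
  "simple_graph G \<longleftrightarrow>
     finite (verts G) \<and> (\<forall>e\<in>edges G. e \<subseteq> verts G \<and> card e = 2)"

definition subgraph :: "'a graph \<Rightarrow> 'a graph \<Rightarrow> bool" where
  "subgraph K G \<longleftrightarrow>
     simple_graph K \<and> verts K \<subseteq> verts G \<and> edges K \<subseteq> edges G"

definition isomorphic :: "'a graph \<Rightarrow> 'b graph \<Rightarrow> bool" where
  "isomorphic G H \<longleftrightarrow>
     (\<exists>f. bij_betw f (verts G) (verts H) \<and> edges H = (\<lambda>e. f ` e) ` edges G)"

definition graph_free :: "'b graph \<Rightarrow> 'a graph \<Rightarrow> bool" where
  "graph_free H G \<longleftrightarrow> \<not> (\<exists>K. subgraph K G \<and> isomorphic K H)"

(* The central edge is {0, 1}; the p leaves at 0 are 2, ..., p + 1 and the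
   q leaves at 1 are p + 2, ..., p + q + 1. *)
definition double_star :: "nat \<Rightarrow> nat \<Rightarrow> nat graph" where
  "double_star p q =
     \<lparr>verts = {..<p + q + 2},
      edges = {{0, 1}} \<union> (\<lambda>i. {0, i}) ` {2..<p + 2}
                \<union> (\<lambda>j. {1, j}) ` {p + 2..<p + q + 2}\<rparr>"

(* The vertex v is drawn as the point \<phi> v and the edge e as the simple arc \<gamma> e.
   The last two clauses say that an arc meets the drawn vertices only in its two
   endpoints, and that two arcs meet only in the point of a common end vertex. *)
definition planar_embedding ::
    "'a graph \<Rightarrow> ('a \<Rightarrow> complex) \<Rightarrow> ('a set \<Rightarrow> real \<Rightarrow> complex) \<Rightarrow> bool" where
  "planar_embedding G \<phi> \<gamma> \<longleftrightarrow>
     inj_on \<phi> (verts G) \<and>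
     (\<forall>e\<in>edges G. arc (\<gamma> e) \<and> {pathstart (\<gamma> e), pathfinish (\<gamma> e)} = \<phi> ` e) \<and>
     (\<forall>e\<in>edges G. path_image (\<gamma> e) \<inter> \<phi> ` verts G = \<phi> ` e) \<and>
     (\<forall>e\<in>edges G. \<forall>f\<in>edges G. e \<noteq> f \<longrightarrow>
        path_image (\<gamma> e) \<inter> path_image (\<gamma> f) = \<phi> ` (e \<inter> f))"

definition drawing ::
    "'a graph \<Rightarrow> ('a \<Rightarrow> complex) \<Rightarrow> ('a set \<Rightarrow> real \<Rightarrow> complex) \<Rightarrow> complex set" where
  "drawing G \<phi> \<gamma> = \<phi> ` verts G \<union> (\<Union>e\<in>edges G. path_image (\<gamma> e))"

(* The drawing of a finite graph is compact, so its unbounded face F is unique. *)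
definition outerplanar :: "'a graph \<Rightarrow> bool" where
  "outerplanar G \<longleftrightarrow>
     (\<exists>\<phi> \<gamma>. planar_embedding G \<phi> \<gamma> \<and>
        (\<exists>F\<in>components (- drawing G \<phi> \<gamma>). \<not> bounded F \<and> \<phi> ` verts G \<subseteq> frontier F))"

(* Taking all vertices in nat loses no finite graph up to isomorphism. The maximum is
   over a finite set, since a simple graph on n vertices has at most n choose 2 edges. *)
definition ex_outerplanar :: "nat \<Rightarrow> 'b graph \<Rightarrow> nat" where
  "ex_outerplanar n H =
     Max {card (edges G) | G :: nat graph.
            simple_graph G \<and> card (verts G) = n \<and> outerplanar G \<and> graph_free H G}"

end

(* From outerplanarity only two facts are used: there is no K_4, and no theta graph whose three
   paths all have interior vertices (a subdivision of K_{2,3}). For the latter, of three arcs with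
   common ends one lies inside the closed curve formed by the other two (by Janiszewski's theorem),
   so its interior vertices are cut off from the outer face.

   An S_{2,2}-free graph has few adjacent vertices of degree at least 3. If there are none,
   a longest path ends in two adjacent vertices of degree 2, and induction gives 2e <= 3(n - 1).
   Otherwise the edges between such vertices lie in fans on five vertices, which are whole
   components, in kites (K_4 minus an edge) or in triangles, with at most one further edge leaving
   at each vertex. Then one deletes a set X of vertices meeting at most 3|X|/2 edges. The only
   components with 2e > 3(n - 1) are the kite with (n, e) = (4, 5) and the fan with (5, 7), and
   only two fans together still beat the bound. *)

theory Submission
  imports Defs
begin

section \<open>Edge counts under forbidden subgraphs\<close>

text \<open>The bound 2e + 3 <= 3n is attained by a single vertex and by triangles sharing a vertex,
  and a deletion pays for itself when X meets at most 3|X|/2 edges. Two obstacles decide which X is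
  taken. The bound fails for the empty graph, so where X may be the whole vertex set the edges are
  counted directly. It also fails for a kite that is a whole component, so no deletion may cut a
  kite off from the rest. Fans are harmless in this respect, since a fan left after a deletion was a
  fan before. A kite with one leaving edge meets 6 edges on 4 vertices, exactly the allowed ratio. A
  kite with two leaving edges meets 7, too many; the outer ends of these edges have degree at most
  2, and including them gives at most 9 edges on 6 vertices. The same count with 6 on 4 or 9 on 6
  settles triangles.\<close>

abbreviation nbrs :: "'a set set \<Rightarrow> 'a \<Rightarrow> 'a set" where
  "nbrs E v \<equiv> {u. {v, u} \<in> E}"

abbreviation walk :: "'a set set \<Rightarrow> 'a list \<Rightarrow> bool" where
  "walk E \<equiv> successively (\<lambda>u v. {u, v} \<in> E)"

abbreviation delete :: "'a set set \<Rightarrow> 'a set \<Rightarrow> 'a set set" where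
  "delete E X \<equiv> {e \<in> E. e \<inter> X = {}}"

text \<open>Degree at least 3, given by witnesses: this passes at once to larger edge sets, and the
  witnesses can serve as leaves of a double star.\<close>

definition branch :: "'a set set \<Rightarrow> 'a \<Rightarrow> bool" where
  "branch E v \<longleftrightarrow> (\<exists>a b c. distinct [a, b, c] \<and> {v, a} \<in> E \<and> {v, b} \<in> E \<and> {v, c} \<in> E)"

text \<open>A subdivision of \<open>K\<^sub>2\<^sub>,\<^sub>3\<close> with branch vertices \<open>x\<close> and \<open>y\<close>, given by the interiors of its three paths.\<close>

definition fat_theta :: "'a set set \<Rightarrow> 'a \<Rightarrow> 'a \<Rightarrow> 'a list \<Rightarrow> 'a list \<Rightarrow> 'a list \<Rightarrow> bool" where
  "fat_theta E x y P Q R \<longleftrightarrow> P \<noteq> [] \<and> Q \<noteq> [] \<and> R \<noteq> [] \<and> distinct (x # y # P @ Q @ R) \<and>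
     walk E (x # P @ [y]) \<and> walk E (x # Q @ [y]) \<and> walk E (x # R @ [y])"

text \<open>The vertices \<open>x\<close> and \<open>y\<close> are the two of degree 3 in the kite.
  It need not be induced; the absence of \<open>{a, b}\<close> comes from \<open>k4\<close>.\<close>

definition kite :: "'a set set \<Rightarrow> 'a \<Rightarrow> 'a \<Rightarrow> 'a \<Rightarrow> 'a \<Rightarrow> bool" where
  "kite E x y a b \<longleftrightarrow> distinct [x, y, a, b] \<and>
     {x, y} \<in> E \<and> {x, a} \<in> E \<and> {x, b} \<in> E \<and> {y, a} \<in> E \<and> {y, b} \<in> E"

definition fan :: "'a set set \<Rightarrow> 'a \<Rightarrow> 'a \<Rightarrow> 'a \<Rightarrow> 'a \<Rightarrow> 'a \<Rightarrow> bool" where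
  "fan E c p q r s \<longleftrightarrow> distinct [c, p, q, r, s] \<and>
     {c, p} \<in> E \<and> {c, q} \<in> E \<and> {c, r} \<in> E \<and> {c, s} \<in> E \<and> {p, q} \<in> E \<and> {q, r} \<in> E \<and> {r, s} \<in> E"

text \<open>Such sets are the unions of connected components, described without speaking of
  connectivity.\<close>

definition closed_in :: "'a set set \<Rightarrow> 'a set \<Rightarrow> bool" where
  "closed_in E W \<longleftrightarrow> (\<forall>e\<in>E. e \<inter> W \<noteq> {} \<longrightarrow> e \<subseteq> W)"

text \<open>All conditions forbid subgraphs, so they pass to vertex deletions and the induction can
  run without carrying a drawing along.\<close>

locale sparse =
  fixes V :: "'a set" and E :: "'a set set"
  assumes fin: "finite V"
    and edge: "e \<in> E \<Longrightarrow> e \<subseteq> V \<and> card e = 2"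
    and s22: "\<lbrakk>{x, y} \<in> E; {x, a} \<in> E; {x, b} \<in> E; {y, c} \<in> E; {y, d} \<in> E;
               distinct [x, y, a, b, c, d]\<rbrakk> \<Longrightarrow> False"
    and k4: "\<lbrakk>kite E x y a b; {a, b} \<in> E\<rbrakk> \<Longrightarrow> False"
    and theta: "\<not> fat_theta E x y P Q R"
begin

lemma inV: "{x, y} \<in> E \<Longrightarrow> x \<in> V \<and> y \<in> V"
  using edge by blast

lemma irrefl: "{x, y} \<in> E \<Longrightarrow> x \<noteq> y"
  using edge by force

lemma loopless [simp]: "{x} \<notin> E"
  using irrefl[of x x] by auto

lemma k23:
  assumes "{a, x} \<in> E" "{a, y} \<in> E" "{a, z} \<in> E" "{b, x} \<in> E" "{b, y} \<in> E" "{b, z} \<in> E"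
    and "distinct [a, b, x, y, z]"
  shows False
  using theta[of a b "[x]" "[y]" "[z]"] assms
  by (auto simp: fat_theta_def insert_commute)

lemma restrict: "sparse (V - X) (delete E X)"
proof
  show "finite (V - X)" using fin by simp
  show "e \<in> delete E X \<Longrightarrow> e \<subseteq> V - X \<and> card e = 2" for e
    using edge[of e] by auto
  show False if "{x, y} \<in> delete E X" "{x, a} \<in> delete E X" "{x, b} \<in> delete E X" "{y, c} \<in> delete E X"
    "{y, d} \<in> delete E X" "distinct [x, y, a, b, c, d]" for x y a b c d
    using that by (intro s22[of x y a b c d]) simp_all
  show "\<And>x y a b. \<lbrakk>kite (delete E X) x y a b; {a, b} \<in> delete E X\<rbrakk> \<Longrightarrow> False"
    using k4 by (auto simp: kite_def)
  have "walk E p" if "walk (delete E X) p" for p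
    using that by (rule successively_mono) auto
  then show "\<not> fat_theta (delete E X) x y P Q R" for x y P Q R
    using theta[of x y P Q R] by (auto simp: fat_theta_def)
qed

lemma incident_edge:
  assumes "e \<in> E" "v \<in> e"
  obtains u where "e = {v, u}"
  using assms edge[of e] by (auto simp: card_2_iff)

text \<open>\<open>L\<close> is a list, so its length bounds the number of lost edges without
  deciding which entries coincide or are edges at all.\<close>

lemma card_del:
  assumes "\<And>v u. \<lbrakk>v \<in> X; {v, u} \<in> E\<rbrakk> \<Longrightarrow> {v, u} \<in> set L"
  shows "card E \<le> card (delete E X) + length L"
proof -
  have "E = delete E X \<union> {e \<in> E. e \<inter> X \<noteq> {}}" by blast
  then have "card E = card (delete E X \<union> {e \<in> E. e \<inter> X \<noteq> {}})" by (rule arg_cong)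
  also have "\<dots> \<le> card (delete E X) + card {e \<in> E. e \<inter> X \<noteq> {}}" by (rule card_Un_le)
  also have "card {e \<in> E. e \<inter> X \<noteq> {}} \<le> card (set L)"
    proof (intro card_mono subsetI)
    fix e assume "e \<in> {e \<in> E. e \<inter> X \<noteq> {}}"
    then obtain v where v: "e \<in> E" "v \<in> e" "v \<in> X" by auto
    then obtain u where "e = {v, u}" using incident_edge by metis
    then show "e \<in> set L" using assms v by metis
  qed simp
  also have "\<dots> \<le> length L" by (rule card_length)
  finally show ?thesis by simp
qed

lemma card_V_del: "X \<subseteq> V \<Longrightarrow> card V = card (V - X) + card X"
  using fin by (simp add: card_Diff_subset card_mono finite_subset)

lemma reduce:
  assumes "\<And>v u. \<lbrakk>v \<in> X; {v, u} \<in> E\<rbrakk> \<Longrightarrow> {v, u} \<in> set L" "X \<subseteq> V" "2 * length L \<le> 3 * card X"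
    and "2 * card (delete E X) + 3 \<le> 3 * card (V - X)"
  shows "2 * card E + 3 \<le> 3 * card V"
proof -
  have "card E \<le> card (delete E X) + length L" by (rule card_del) (rule assms(1))
  then show ?thesis using card_V_del[OF assms(2)] assms(3,4) by linarith
qed

end

section \<open>Graphs without adjacent vertices of degree at least 3\<close>

text \<open>Two vertices joined by three internally disjoint paths are branch vertices, hence not
  adjacent here; so all three paths have interior vertices and \<open>theta\<close> excludes them.
  Every block is therefore an edge or a cycle, which makes the graph a cactus, and 3(n - 1)/2 is the
  usual bound for cacti.\<close>

lemma cactus_bound:
  assumes "sparse V E" "V \<noteq> {}" "\<And>x y. \<lbrakk>{x, y} \<in> E; branch E x; branch E y\<rbrakk> \<Longrightarrow> False"
  shows "2 * card E + 3 \<le> 3 * card V"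
  using assms
proof (induction "card V" arbitrary: V E rule: less_induct)
  case less
  interpret sparse V E by fact
  note indep = less.prems(3)
  have IH: "2 * card (delete E X) + 3 \<le> 3 * card (V - X)" if "V - X \<noteq> {}" "X \<subseteq> V" "X \<noteq> {}" for X
  proof (rule less.hyps)
    show "card (V - X) < card V"
      using that fin by (intro psubset_card_mono) auto
    show "sparse (V - X) (delete E X)" by (rule restrict)
    show "False" if "{x, y} \<in> delete E X" "branch (delete E X) x" "branch (delete E X) y" for x y
    proof -
      have "branch E x" "branch E y" using that by (auto simp: branch_def)
      then show False using that indep by blast
    qed
  qed fact
  show ?case
  \<comment> \<open>The inclusion covers degrees 0 and 1. Otherwise all degrees are at least 2,
    which \<open>two\<close> records in the form used below.\<close>
  proof (cases "\<exists>v\<in>V. \<exists>u. nbrs E v \<subseteq> {u}")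
    case True
    then obtain v u where v: "v \<in> V" "nbrs E v \<subseteq> {u}" by blast
    show ?thesis
    proof (cases "V = {v}")
      case True
      have "e \<notin> E" for e
      proof
        assume "e \<in> E"
        then have "e \<subseteq> {v}" "card e = 2" using edge True by auto
        then show False by (auto simp: subset_singleton_iff)
      qed
      then have "E = {}" by blast
      then show ?thesis using True by simp
    next
      case False
      then have "V - {v} \<noteq> {}" using v by blast
      then have "2 * card (delete E {v}) + 3 \<le> 3 * card (V - {v})" using v(1) by (intro IH) simp_all
      moreover have "{w, t} \<in> set [{v, u}]" if "w \<in> {v}" "{w, t} \<in> E" for w t
        using v(2) that by auto
      ultimately show ?thesis using v(1) by (intro reduce[of "{v}" "[{v, u}]"]) simp_all
    qed
  next
    case False
    have two: "\<exists>t. {v, t} \<in> E \<and> t \<noteq> u" if "v \<in> V" for v u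
      using False that by blast
    let ?P = "\<lambda>p. p \<noteq> [] \<and> distinct p \<and> set p \<subseteq> V \<and> walk E p"
    obtain z where "z \<in> V" using less.prems by blast
    then have z: "?P [z]" by simp
    have "length p < Suc (card V)" if "?P p" for p
      using that fin by (metis card_mono distinct_card le_imp_less_Suc)
    then obtain p where p: "?P p" and long: "\<And>p'. ?P p' \<Longrightarrow> length p' \<le> length p"
      using ex_has_greatest_nat[of ?P "[z]" length "Suc (card V)"] z by (metis less_imp_le)
    obtain v0 p' where p0: "p = v0 # p'" using p by (cases p) auto
    have ext: "t \<in> set p" if "{v0, t} \<in> E" for t
    proof (rule ccontr)
      assume "t \<notin> set p"
      then have "?P (t # p)" using p p0 that inV[OF that] by (auto simp: insert_commute)
      from long[OF this] show False by simp
    qed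
    obtain v1 q where p1: "p' = v1 # q"
    proof (cases p')
      case Nil
      have "v0 \<in> V" using p p0 by simp
      with two[of v0] obtain t where "{v0, t} \<in> E" by blast
      then show ?thesis using ext[of t] irrefl[of v0 t] p0 Nil by auto
    qed auto
    note pp = p0 p1
    have e01: "{v0, v1} \<in> E" and wq: "walk E (v1 # q)" and dq: "distinct (v0 # v1 # q)"
      and Vq: "set (v0 # v1 # q) \<subseteq> V"
      using p pp by auto
    obtain t where t: "{v0, t} \<in> E" "t \<noteq> v1" using two[of v0 v1] Vq by auto
    then have "t \<in> set q" using ext[of t] irrefl[of v0 t] pp by auto
    then have "\<exists>t\<in>set q. {v0, t} \<in> E" using t by blast
    \<comment> \<open>\<open>u\<close> is the first neighbour of \<open>v0\<close> after
      \<open>v1\<close> along the path. So \<open>v0\<close>, \<open>v1\<close>, \<open>q1\<close>,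
      \<open>u\<close> close up to a cycle, and a third neighbour of \<open>v0\<close> lies beyond
      \<open>u\<close>, which would make both \<open>v0\<close> and \<open>u\<close> branch
      vertices.\<close>
    then obtain q1 u q2 where q: "q = q1 @ u # q2" and u: "{v0, u} \<in> E"
      and first: "\<And>t. t \<in> set q1 \<Longrightarrow> {v0, t} \<notin> E"
      by (auto elim!: split_list_first_propE)
    have branchI: "branch E w" if "{w, a} \<in> E" "{w, b} \<in> E" "{w, c} \<in> E" "distinct [a, b, c]" for w a b c
      using that unfolding branch_def by blast
    have last_adj: "{last (v1 # q1), u} \<in> E" and w1: "walk E (v1 # q1)" and w2: "walk E (u # q2)"
      using wq q successively_append_iff[of _ "v1 # q1" "u # q2"] by auto
    have lastin: "last (v1 # q1) \<in> insert v1 (set q1)"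
      by (metis last_in_set list.distinct(1) list.simps(15))
    have nb0: "nbrs E v0 = {v1, u}"
    proof -
      have False if t: "{v0, t} \<in> E" "t \<noteq> v1" "t \<noteq> u" for t
      proof -
        have "t \<in> set q2"
          using ext[OF t(1)] t irrefl[OF t(1)] first[of t] pp q by auto
        then obtain h q2' where q2: "q2 = h # q2'" by (cases q2) auto
        have "branch E u"
          by (rule branchI[of u v0 "last (v1 # q1)" h])
             (use u last_adj w2 q2 dq q lastin in \<open>auto simp: insert_commute simp del: last.simps\<close>)
        moreover have "branch E v0"
          by (rule branchI[of v0 v1 u t]) (use e01 u t dq q in auto)
        ultimately show False using indep u by blast
      qed
      then show ?thesis using e01 u by auto
    qed
    obtain v2 q' where v2: "q = v2 # q'" using q by (metis append_is_Nil_conv list.distinct(1) list.exhaust)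
    have e12: "{v1, v2} \<in> E" using wq v2 by simp
    \<comment> \<open>A third neighbour \<open>w\<close> makes \<open>v1\<close> a branch vertex, so
      no neighbour of \<open>v1\<close> may be one. Each position of \<open>w\<close> leads to a
      branch neighbour, to a longer path or to a fat theta.\<close>
    have nb1: "nbrs E v1 = {v0, v2}"
    proof -
      have False if w: "{v1, w} \<in> E" "w \<noteq> v0" "w \<noteq> v2" for w
      proof -
        have b1: "branch E v1"
          by (rule branchI[of v1 v0 v2 w]) (use e01 e12 w dq v2 in \<open>auto simp: insert_commute\<close>)
        have ww: "w \<noteq> v1" "w \<in> V" using irrefl[OF w(1)] inV[OF w(1)] by auto
        show False
        proof (cases q1)
          case Nil
          then have uv: "u = v2" using q v2 by simp
          show False
          proof (cases "w \<in> set q2")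
            case True
            then obtain h q2' where q2: "q2 = h # q2'" by (cases q2) auto
            have "branch E u"
              by (rule branchI[of u v0 v1 h])
                 (use u e12 w2 q2 dq q uv in \<open>auto simp: insert_commute\<close>)
            then show False using indep b1 e12 uv by blast
          next
            case False
            \<comment> \<open>In the triangle \<open>v0\<close>, \<open>v1\<close>, \<open>u\<close>
              the path can be rerouted through \<open>v0\<close>, which frees \<open>v1\<close> to
              be continued to \<open>w\<close>.\<close>
            have "?P (w # v1 # v0 # u # q2)"
              using w ww False dq q Vq w2 e01 u uv by (auto simp: insert_commute)
            from long[OF this] show False using pp q Nil by simp
          qed
        next
          case (Cons v q1')
          then have Q: "q1 = v2 # q1'" using q v2 by simp
          have w1': "walk E (v2 # q1' @ [u])"
            using w1 last_adj Q successively_append_iff[of _ "v2 # q1'" "[u]"]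
            by (auto simp: successively_Cons split: if_splits)
          have rev_walk: "walk E (t # rev r1 @ [u])" if "q2 = r1 @ t # r2" for t r1 r2
          proof -
            have "walk E ((u # r1 @ [t]) @ r2)" using w2 that by simp
            then have "walk E (u # r1 @ [t])" by (rule successively_append_iff[THEN iffD1, THEN conjunct1])
            then have "walk E (rev (u # r1 @ [t]))"
              by (simp only: successively_rev) (simp add: insert_commute)
            then show ?thesis by simp
          qed
          \<comment> \<open>The cycle supplies two paths from \<open>v1\<close> to \<open>u\<close>,
            one through \<open>v0\<close> and one through \<open>q1\<close>; only a third path
            \<open>R\<close> off the cycle has to be found.\<close>
          have th1: "fat_theta E v1 u [v0] (v2 # q1') R"
            if "R \<noteq> []" "distinct R" "set R \<inter> {v0, v1, u, v2} = {}" "set R \<inter> set q1' = {}"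
              "walk E (v1 # R @ [u])" for R
            using that dq q Q e01 u e12 w1' by (auto simp: fat_theta_def insert_commute)
          show False
          proof (cases "w \<in> set q")
            case True
            then consider "w \<in> set q1'" | "w = u" | "w \<in> set q2"
              using q Q w by auto
            then show False
            proof cases
              case 1
              then obtain s1 s2 where s: "q1' = s1 @ w # s2" by (meson split_list)
              have "walk E ((v2 # s1) @ w # (s2 @ [u]))" using w1' s by simp
              then have a: "{last (v2 # s1), w} \<in> E" and b: "{w, hd (s2 @ [u])} \<in> E"
                unfolding successively_append_iff by (auto simp: successively_Cons)
              have l: "last (v2 # s1) \<in> insert v2 (set s1)"
                by (metis last_in_set list.distinct(1) list.simps(15))
              have h: "hd (s2 @ [u]) \<in> insert u (set s2)" by (cases s2) auto
              have "branch E w"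
                by (rule branchI[of w "last (v2 # s1)" v1 "hd (s2 @ [u])"])
                   (use a b l h w dq q Q s in \<open>auto simp: insert_commute simp del: last.simps\<close>)
              then show False using indep b1 w by blast
            next
              case 2
              have a: "{last q1, u} \<in> E" using last_adj Q by simp
              have l: "last q1 \<in> set q1" using Q by simp
              have "branch E u"
                by (rule branchI[of u "last q1" v1 v0])
                   (use a l w dq q 2 u in \<open>auto simp: insert_commute\<close>)
              then show False using indep b1 w 2 by blast
            next
              case 3
              then obtain r1 r2 where r: "q2 = r1 @ w # r2" by (meson split_list)
              have "fat_theta E v1 u [v0] (v2 # q1') (w # rev r1)"
                by (rule th1) (use r dq q Q w rev_walk[OF r] in auto)
              then show False using theta by blast
            qed
          next
            case False
            \<comment> \<open>Putting \<open>w2\<close> and \<open>w\<close> in place of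
              \<open>v0\<close> lengthens the path by one, so maximality forces \<open>w2\<close>
              onto \<open>q\<close>, where it closes a further path from \<open>v1\<close>.\<close>
            obtain w2 where w2: "{w, w2} \<in> E" "w2 \<noteq> v1" using two ww by blast
            have w2': "w2 \<noteq> w" "w2 \<in> V" using irrefl[OF w2(1)] inV[OF w2(1)] by auto
            have wu: "w \<noteq> u" using False q by auto
            have w20: "w2 \<noteq> v0"
            proof
              assume "w2 = v0"
              then have "w \<in> nbrs E v0" using w2 by (simp add: insert_commute)
              then show False using nb0 ww wu by auto
            qed
            have "w2 \<in> set q"
            proof (rule ccontr)
              assume "w2 \<notin> set q"
              then have "?P (w2 # w # v1 # q)"
                using w w2 ww w2' False dq Vq wq w20 by (auto simp: insert_commute)
              from long[OF this] show False using pp by simp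
            qed
            then consider "w2 = v2" | "w2 \<in> set q1'" | "w2 = u" | "w2 \<in> set q2"
              using q Q by auto
            then show False
            proof cases
              case 1
              have a: "{v2, hd (q1' @ [u])} \<in> E" using w1' by (cases q1') auto
              have h: "hd (q1' @ [u]) \<in> insert u (set q1')" by (cases q1') auto
              have "branch E v2"
                by (rule branchI[of v2 v1 w "hd (q1' @ [u])"])
                   (use a h w ww w2 1 dq q Q e12 False in \<open>auto simp: insert_commute\<close>)
              then show False using indep b1 e12 by blast
            next
              case 2
              then obtain s1 s2 where s: "q1' = s1 @ w2 # s2" by (meson split_list)
              have "walk E ((v2 # s1 @ [w2]) @ s2 @ [u])" using w1' s by simp
              then have a: "walk E (v2 # s1 @ [w2])" by (rule successively_append_iff[THEN iffD1, THEN conjunct1])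
              have "walk E ((v2 # s1) @ (w2 # s2 @ [u]))" using w1' s by simp
              then have "walk E (w2 # s2 @ [u])" by (simp only: successively_append_iff)
              then have "walk E (rev (w2 # s2 @ [u]))"
                by (simp only: successively_rev) (simp add: insert_commute)
              then have b: "walk E (u # rev s2 @ [w2])" by simp
              have "fat_theta E v1 w2 (v2 # s1) [w] (v0 # u # rev s2)"
                using a b w w2 ww w2' e01 u e12 dq q Q s False by (auto simp: fat_theta_def insert_commute)
              then show False using theta by blast
            next
              case 3
              have "fat_theta E v1 u [v0] (v2 # q1') [w]"
                by (rule th1) (use 3 w ww wu w2 False q Q in auto)
              then show False using theta by blast
            next
              case 4
              then obtain r1 r2 where r: "q2 = r1 @ w2 # r2" by (meson split_list)
              have "fat_theta E v1 u [v0] (v2 # q1') (w # w2 # rev r1)"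
                by (rule th1) (use r dq q Q w w2 ww w2' wu w20 False rev_walk[OF r] in auto)
              then show False using theta by blast
            qed
          qed
        qed
      qed
      then show ?thesis using e01 e12 by (auto simp: insert_commute)
    qed
    have X: "{v0, v1} \<subseteq> V" "v0 \<noteq> v1" using Vq dq by auto
    have "v2 \<in> V - {v0, v1}" using Vq v2 dq by auto
    then have "2 * card (delete E {v0, v1}) + 3 \<le> 3 * card (V - {v0, v1})"
      using X(1) by (intro IH) auto
    moreover have n0: "t = v1 \<or> t = u" if "{v0, t} \<in> E" for t using nb0 that by auto
    moreover have n1: "t = v0 \<or> t = v2" if "{v1, t} \<in> E" for t using nb1 that by auto
    moreover have "{v, t} \<in> set [{v0, v1}, {v0, u}, {v1, v2}]" if "v \<in> {v0, v1}" "{v, t} \<in> E" for v t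
      using that n0[of t] n1[of t] by auto
    ultimately show ?thesis
      using X by (intro reduce[of "{v0, v1}" "[{v0, v1}, {v0, u}, {v1, v2}]"]) simp_all
  qed
qed

text \<open>The edges leaving \<open>W\<close>: only \<open>pd\<close>, respectively only \<open>au\<close> and \<open>bw\<close>. The last clauses
  say that the outer ends have degree at most 2.\<close>

definition one_tail :: "'a set set \<Rightarrow> 'a set \<Rightarrow> 'a \<Rightarrow> 'a \<Rightarrow> bool" where
  "one_tail E W p d \<longleftrightarrow> p \<in> W \<and> d \<notin> W \<and> {p, d} \<in> E \<and>
     (\<forall>v\<in>W. \<forall>t. {v, t} \<in> E \<longrightarrow> t \<in> W \<or> v = p \<and> t = d) \<and>
     (\<forall>r s. {d, r} \<in> E \<longrightarrow> {d, s} \<in> E \<longrightarrow> r \<noteq> p \<longrightarrow> s \<noteq> p \<longrightarrow> r = s)"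

definition two_tail :: "'a set set \<Rightarrow> 'a set \<Rightarrow> 'a \<Rightarrow> 'a \<Rightarrow> 'a \<Rightarrow> 'a \<Rightarrow> bool" where
  "two_tail E W a u b w \<longleftrightarrow> u \<notin> W \<and> w \<notin> W \<and> u \<noteq> w \<and> {a, u} \<in> E \<and> {b, w} \<in> E \<and>
     (\<forall>v\<in>W. \<forall>t. {v, t} \<in> E \<longrightarrow> t \<in> W \<or> v = a \<and> t = u \<or> v = b \<and> t = w) \<and>
     (\<forall>r s. {u, r} \<in> E \<longrightarrow> {u, s} \<in> E \<longrightarrow> r \<noteq> a \<longrightarrow> s \<noteq> a \<longrightarrow> r = s) \<and>
     (\<forall>r s. {w, r} \<in> E \<longrightarrow> {w, s} \<in> E \<longrightarrow> r \<noteq> b \<longrightarrow> s \<noteq> b \<longrightarrow> r = s)"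

lemma kite_del: "kite (delete E X) x y a b \<Longrightarrow> kite E x y a b \<and> {x, y, a, b} \<inter> X = {}"
  by (auto simp: kite_def)

lemma fan_del: "fan (delete E X) c p q r s \<Longrightarrow> fan E c p q r s"
  by (auto simp: fan_def)

lemma kite_swap: "kite E x y a b \<Longrightarrow> kite E y x a b" "kite E x y a b \<Longrightarrow> kite E x y b a"
  by (auto simp: kite_def insert_commute)

lemma closed_inD: "\<lbrakk>closed_in E W; {v, t} \<in> E; v \<in> W\<rbrakk> \<Longrightarrow> t \<in> W"
  unfolding closed_in_def by (metis disjoint_iff insertI1 insert_subset)

section \<open>Edges leaving fans, kites and triangles\<close>

context sparse
begin

lemma sym: "{a, b} \<in> E \<Longrightarrow> {b, a} \<in> E"
  by (simp add: insert_commute)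

lemma closed_inI:
  assumes "\<And>v t. \<lbrakk>v \<in> W; {v, t} \<in> E\<rbrakk> \<Longrightarrow> t \<in> W"
  shows "closed_in E W"
  unfolding closed_in_def
proof (intro ballI impI)
  fix e assume e: "e \<in> E" "e \<inter> W \<noteq> {}"
  then obtain v where v: "v \<in> e" "v \<in> W" by blast
  then obtain t where "e = {v, t}" using e incident_edge by metis
  then show "e \<subseteq> W" using assms[of v t] e v by simp
qed

text \<open>A fan already holds five of the six vertices of a double star. Whichever of them has an
  outside neighbour, some central edge inside the fan makes that neighbour the missing leaf.\<close>

lemma fan_closed:
  assumes "fan E c p q r s"
  shows "closed_in E {c, p, q, r, s}"
proof (rule closed_inI)
  have d: "distinct [c, p, q, r, s]" and e: "{c, p} \<in> E" "{c, q} \<in> E" "{c, r} \<in> E" "{c, s} \<in> E"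
    "{p, q} \<in> E" "{q, r} \<in> E" "{r, s} \<in> E"
    using assms by (auto simp: fan_def)
  note e = e e[THEN sym]
  fix v t assume v: "v \<in> {c, p, q, r, s}" and t: "{v, t} \<in> E"
  show "t \<in> {c, p, q, r, s}"
  proof (rule ccontr)
    assume "t \<notin> {c, p, q, r, s}"
    then have n: "t \<noteq> c" "t \<noteq> p" "t \<noteq> q" "t \<noteq> r" "t \<noteq> s" by auto
    from v consider "v = c" | "v = p" | "v = q" | "v = r" | "v = s" by blast
    then show False
    proof cases
      case 1 show ?thesis by (rule s22[of c q t s p r]) (use e d n t 1 in auto)
    next
      case 2 show ?thesis by (rule s22[of p c t q r s]) (use e d n t 2 in auto)
    next
      case 3 show ?thesis by (rule s22[of q c t p r s]) (use e d n t 3 in auto)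
    next
      case 4 show ?thesis by (rule s22[of r c t s p q]) (use e d n t 4 in auto)
    next
      case 5 show ?thesis by (rule s22[of s c t r p q]) (use e d n t 5 in auto)
    qed
  qed
qed

lemma kite_inner:
  assumes "kite E x y a b" "v \<in> {x, y, a, b}" "t \<in> {x, y, a, b}" "{v, t} \<in> E"
  shows "{v, t} \<in> set [{x, y}, {x, a}, {x, b}, {y, a}, {y, b}]"
proof -
  have "{a, b} \<notin> E" using k4 assms(1) by blast
  then show ?thesis using assms(2-4)
    by (elim insertE emptyE; hypsubst) (simp_all add: insert_commute)
qed

text \<open>\<open>{p, r}\<close> or \<open>{q, s}\<close> would complete a K_4, and
  \<open>{p, s}\<close> would make \<open>q\<close> and \<open>s\<close> both adjacent to
  \<open>c\<close>, \<open>p\<close> and \<open>r\<close>, a K_{2,3}.\<close>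

lemma fan_inner:
  assumes "fan E c p q r s" "v \<in> {c, p, q, r, s}" "t \<in> {c, p, q, r, s}" "{v, t} \<in> E"
  shows "{v, t} \<in> set [{c, p}, {c, q}, {c, r}, {c, s}, {p, q}, {q, r}, {r, s}]"
proof -
  have d: "distinct [c, p, q, r, s]" and e: "{c, p} \<in> E" "{c, q} \<in> E" "{c, r} \<in> E" "{c, s} \<in> E"
    "{p, q} \<in> E" "{q, r} \<in> E" "{r, s} \<in> E"
    using assms by (auto simp: fan_def)
  note e = e e[THEN sym]
  have "{p, r} \<notin> E" using k4[of c q p r] d e by (auto simp: kite_def)
  moreover have "{q, s} \<notin> E" using k4[of c r q s] d e by (auto simp: kite_def)
  moreover have "{p, s} \<notin> E" using k23[of q c p r s] k23[of q s c r p] d e sym[of p s] by auto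
  ultimately show ?thesis using assms(2-4)
    by (elim insertE emptyE; hypsubst) (simp_all add: insert_commute)
qed

text \<open>Once \<open>d\<close> is attached to \<open>x\<close>, an outside neighbour of the kite
  other than \<open>d\<close> completes a double star. A second edge to \<open>d\<close> itself
  gives K_{2,3} at \<open>y\<close> and a fan around \<open>x\<close> at \<open>a\<close> or
  \<open>b\<close>.\<close>

lemma kite_hub:
  assumes k: "kite E x y a b" and nofan: "\<And>c p q r s. \<not> fan E c p q r s"
    and xd: "{x, d} \<in> E" and d: "d \<notin> {x, y, a, b}"
  shows "one_tail E {x, y, a, b} x d"
proof -
  have ds: "distinct [x, y, a, b]" and e: "{x, y} \<in> E" "{x, a} \<in> E" "{x, b} \<in> E" "{y, a} \<in> E" "{y, b} \<in> E"
    using k by (auto simp: kite_def)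
  note e = e e[THEN sym] xd
  have nx: "t \<in> {x, y, a, b} \<or> t = d" if t: "{x, t} \<in> E" for t
    using s22[of x y d t a b] t ds d e by auto
  have ny: "t \<in> {x, y, a, b}" if t: "{y, t} \<in> E" for t
  proof (rule ccontr)
    assume n: "t \<notin> {x, y, a, b}"
    show False
    proof (cases "t = d")
      case True
      then show False using k23[of x a b d y] t ds d e by auto
    next
      case False
      then show False using s22[of x y d a t b] t ds d e n by auto
    qed
  qed
  have nab: "t \<in> {x, y, a, b}" if t: "{v, t} \<in> E" and v: "v = a \<and> v' = b \<or> v = b \<and> v' = a" for t v v'
  proof (rule ccontr)
    assume n: "t \<notin> {x, y, a, b}"
    show False
    proof (cases "t = d")
      case True
      have "fan E x d v y v'" using True t v ds d e sym[OF t] by (auto simp: fan_def)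
      then show False using nofan by blast
    next
      case False
      then show False using s22[of v x t y d v'] t ds d e n v by auto
    qed
  qed
  have nd: "r = s" if r: "{d, r} \<in> E" "r \<noteq> x" and s: "{d, s} \<in> E" "s \<noteq> x" for r s
  proof (rule ccontr)
    assume "r \<noteq> s"
    have out: "q \<notin> {x, y, a, b}" if "{d, q} \<in> E" "q \<noteq> x" for q
      using sym[OF that(1)] ny[of d] nab[of a d b] nab[of b d a] that d by blast
    show False
      by (rule s22[of x d a b r s]) (use out[OF r] out[OF s] r s e d ds \<open>r \<noteq> s\<close> irrefl in auto)
  qed
  show ?thesis unfolding one_tail_def
  proof (intro conjI ballI allI impI)
    fix v t assume "v \<in> {x, y, a, b}" "{v, t} \<in> E"
    then show "t \<in> {x, y, a, b} \<or> v = x \<and> t = d"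
      using nx ny nab[of a t b] nab[of b t a] by blast
  qed (use d xd nd in auto)
qed

text \<open>If nothing leaves at \<open>x\<close> or \<open>y\<close>, at most one edge leaves at
  each of \<open>a\<close> and \<open>b\<close>. Their outer ends differ, because a common one would
  be a third common neighbour of \<open>a\<close> and \<open>b\<close> besides \<open>x\<close> and
  \<open>y\<close>.\<close>

lemma kite_tails:
  assumes k: "kite E x y a b" and nofan: "\<And>c p q r s. \<not> fan E c p q r s"
    and open_kite: "\<not> closed_in E {x, y, a, b}"
  shows "(\<exists>p d. one_tail E {x, y, a, b} p d) \<or> (\<exists>u w. two_tail E {x, y, a, b} a u b w)"
proof (cases "\<exists>d. d \<notin> {x, y, a, b} \<and> ({x, d} \<in> E \<or> {y, d} \<in> E)")
  case True
  then show ?thesis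
    using kite_hub[OF k nofan] kite_hub[OF kite_swap(1)[OF k] nofan] by (metis insert_commute)
next
  case False
  have ds: "distinct [x, y, a, b]" and e: "{x, y} \<in> E" "{x, a} \<in> E" "{x, b} \<in> E" "{y, a} \<in> E" "{y, b} \<in> E"
    using k by (auto simp: kite_def)
  note e = e e[THEN sym]
  have nxy: "t \<in> {x, y, a, b}" if "{x, t} \<in> E \<or> {y, t} \<in> E" for t using False that by blast
  have nab: "s = t" if "{v, s} \<in> E" "s \<notin> {x, y, a, b}" "{v, t} \<in> E" "t \<notin> {x, y, a, b}"
    and v: "v = a \<and> v' = b \<or> v = b \<and> v' = a" for s t v v'
    using s22[of v x s t y v'] that ds e by auto
  have uniq: "r = s" if v: "v \<in> {a, b}" and u: "{v, u} \<in> E" "u \<notin> {x, y, a, b}"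
    and "{u, r} \<in> E" "r \<noteq> v" "{u, s} \<in> E" "s \<noteq> v" for v u r s
  proof (rule ccontr)
    assume "r \<noteq> s"
    have out: "q \<noteq> x" "q \<noteq> y" if "{u, q} \<in> E" for q
      using that nxy[of u] u sym[of u q] by auto
    show False
      by (rule s22[of v u x y r s]) (use that out[of r] out[of s] e ds \<open>r \<noteq> s\<close> irrefl in auto)
  qed
  obtain v t where vt: "v \<in> {x, y, a, b}" "{v, t} \<in> E" "t \<notin> {x, y, a, b}"
    using open_kite closed_inI by blast
  then have v: "v \<in> {a, b}" using nxy by blast
  show ?thesis
  proof (cases "\<exists>u w. {a, u} \<in> E \<and> u \<notin> {x, y, a, b} \<and> {b, w} \<in> E \<and> w \<notin> {x, y, a, b}")
    case True
    then obtain u w where uw: "{a, u} \<in> E" "u \<notin> {x, y, a, b}" "{b, w} \<in> E" "w \<notin> {x, y, a, b}" by blast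
    have "u \<noteq> w" using k23[of a x y u b] uw ds e by auto
    moreover have "t \<in> {x, y, a, b} \<or> v = a \<and> t = u \<or> v = b \<and> t = w"
      if "v \<in> {x, y, a, b}" "{v, t} \<in> E" for v t
      using that nxy[of t] nab[of a t u b] nab[of b t w a] uw by blast
    ultimately have "two_tail E {x, y, a, b} a u b w"
      unfolding two_tail_def using uw uniq[of a u] uniq[of b w] by blast
    then show ?thesis by blast
  next
    case False
    have "one_tail E {x, y, a, b} v t" unfolding one_tail_def
    proof (intro conjI ballI allI impI)
      fix v2 t2 assume "v2 \<in> {x, y, a, b}" "{v2, t2} \<in> E"
      then show "t2 \<in> {x, y, a, b} \<or> v2 = v \<and> t2 = t"
        using nxy[of t2] nab[of a t2 t b] nab[of b t2 t a] False vt v by blast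
    next
      fix r s assume "{t, r} \<in> E" "{t, s} \<in> E" "r \<noteq> v" "s \<noteq> v"
      then show "r = s" using uniq[of v t r s] v vt by blast
    qed (use vt in auto)
    then show ?thesis by blast
  qed
qed

text \<open>A kite cut off by deleting \<open>X\<close> was attached to \<open>X\<close> at a vertex
  that keeps two neighbours. This is used against tail ends, which keep at most one.\<close>

lemma leaving:
  assumes k: "kite (delete E X) x y a b" and "closed_in (delete E X) {x, y, a, b}"
    and "\<not> closed_in E {x, y, a, b}"
  obtains v u r s where "v \<in> {x, y, a, b}" "u \<in> X" "{v, u} \<in> E" "v \<notin> X" "r \<noteq> s"
    "{v, r} \<in> E" "{v, s} \<in> E" "r \<notin> X" "s \<notin> X"
proof -
  obtain v u where vu: "v \<in> {x, y, a, b}" "{v, u} \<in> E" "u \<notin> {x, y, a, b}"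
    using assms(3) closed_inI by blast
  have X: "{x, y, a, b} \<inter> X = {}" and k': "kite E x y a b" using kite_del[OF k] by auto
  have vX: "v \<notin> X" using vu X by blast
  have "u \<in> X"
  proof (rule ccontr)
    assume "u \<notin> X"
    then have "{v, u} \<in> delete E X" using vu vX by simp
    from closed_inD[OF assms(2) this vu(1)] vu(3) show False by contradiction
  qed
  moreover have "\<exists>r s. r \<noteq> s \<and> {v, r} \<in> E \<and> {v, s} \<in> E \<and> r \<in> {x, y, a, b} \<and> s \<in> {x, y, a, b}"
  proof -
    from vu(1) consider "v = x" | "v = y" | "v = a" | "v = b" by blast
    then show ?thesis
    proof cases
      case 1 then show ?thesis using k' by (intro exI[of _ a] exI[of _ b]) (auto simp: kite_def)
    next
      case 2 then show ?thesis using k' by (intro exI[of _ a] exI[of _ b]) (auto simp: kite_def)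
    next
      case 3 then show ?thesis using k' by (intro exI[of _ x] exI[of _ y]) (auto simp: kite_def insert_commute)
    next
      case 4 then show ?thesis using k' by (intro exI[of _ x] exI[of _ y]) (auto simp: kite_def insert_commute)
    qed
  qed
  ultimately show ?thesis using that vu(1,2) vX X by blast
qed

text \<open>An outer neighbour shared by two corners would give a kite; without sharing, any surplus
  edge gives a double star around \<open>{x, y}\<close> or \<open>{x', x}\<close>. Only one corner
  is described; the others follow by permuting the names.\<close>

lemma triangle_corner:
  assumes nokite: "\<And>x y a b. \<not> kite E x y a b"
    and e: "{x, y} \<in> E" "{x, a} \<in> E" "{y, a} \<in> E" "{x, x'} \<in> E" "{y, y'} \<in> E"
    and d: "distinct [x, y, a]" "x' \<notin> {x, y, a}" "y' \<notin> {x, y, a}"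
  shows "x' \<noteq> y'" "{x, t} \<in> E \<Longrightarrow> t = y \<or> t = a \<or> t = x'"
    "\<exists>x''. \<forall>t. {x', t} \<in> E \<longrightarrow> t = x \<or> t = x''"
proof -
  note e = e e[THEN sym]
  have kx: "\<not> kite E x y a t" "\<not> kite E x a y t" for t using nokite by auto
  show ne: "x' \<noteq> y'" using kx(1)[of x'] e d by (auto simp: kite_def)
  show "t = y \<or> t = a \<or> t = x'" if t: "{x, t} \<in> E"
  proof (rule ccontr)
    assume n: "\<not> ?thesis"
    have "t \<noteq> y'" using kx(1)[of t] e d t n by (auto simp: kite_def)
    then show False using s22[of x y t x' a y'] e d t n ne irrefl[OF t] by auto
  qed
  have uniq: "r = s" if r: "{x', r} \<in> E" "r \<noteq> x" and s: "{x', s} \<in> E" "s \<noteq> x" for r s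
  proof (rule ccontr)
    assume "r \<noteq> s"
    have "q \<noteq> y \<and> q \<noteq> a" if "{x', q} \<in> E" for q
      using kx(1)[of x'] kx(2)[of x'] e d sym[OF that] by (auto simp: kite_def)
    then show False using s22[of x' x r s y a] e d r s irrefl[of x' r] irrefl[of x' s] \<open>r \<noteq> s\<close> by auto
  qed
  show "\<exists>x''. \<forall>t. {x', t} \<in> E \<longrightarrow> t = x \<or> t = x''"
  proof (cases "\<exists>r. {x', r} \<in> E \<and> r \<noteq> x")
    case True
    then show ?thesis using uniq by blast
  qed blast
qed

lemma del_V: "V \<subseteq> X \<Longrightarrow> delete E X = {}"
proof -
  assume X: "V \<subseteq> X"
  have "e \<inter> X \<noteq> {}" if "e \<in> E" for e
    using edge[OF that] X by (metis Int_absorb2 card.empty order_trans zero_neq_numeral)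
  then show ?thesis by blast
qed

end

section \<open>Deleting kites and triangles\<close>

text \<open>The condition on kites is not inherited by subgraphs, so each deletion of a kite has to
  show that it isolates no other one. Once the graph has no kites the induction hypothesis applies
  freely, as \<open>IH'\<close>.\<close>

lemma no_closed_component_bound:
  assumes "sparse V E" "V \<noteq> {}" "\<And>c p q r s. \<not> fan E c p q r s"
    and "\<And>x y a b. kite E x y a b \<Longrightarrow> \<not> closed_in E {x, y, a, b}"
  shows "2 * card E + 3 \<le> 3 * card V"
  using assms
proof (induction "card V" arbitrary: V E rule: less_induct)
  case less
  interpret sparse V E by fact
  note nofan = less.prems(3) and kopen = less.prems(4)
  have IH: "2 * card (delete E X) + 3 \<le> 3 * card (V - X)"
    if "V - X \<noteq> {}" "X \<subseteq> V" "X \<noteq> {}"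
      "\<And>x y a b. kite (delete E X) x y a b \<Longrightarrow> \<not> closed_in (delete E X) {x, y, a, b}" for X
  proof (rule less.hyps)
    show "card (V - X) < card V"
      using that fin by (intro psubset_card_mono) auto
    show "sparse (V - X) (delete E X)" by (rule restrict)
    show "\<not> fan (delete E X) c p q r s" for c p q r s using fan_del nofan by metis
  qed fact+
  show ?case
  proof (cases "\<exists>x y a b. kite E x y a b")
    case True
    show ?thesis
    proof (cases "\<exists>x y a b p d. kite E x y a b \<and> one_tail E {x, y, a, b} p d")
      case True
      then obtain x y a b p d where k: "kite E x y a b" and t: "one_tail E {x, y, a, b} p d" by blast
      let ?W = "{x, y, a, b}"
      have pd: "p \<in> ?W" "d \<notin> ?W" "{p, d} \<in> E" using t by (auto simp: one_tail_def)
      have nW: "t \<in> ?W \<or> v = p \<and> t = d" if "v \<in> ?W" "{v, t} \<in> E" for v t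
        using t that unfolding one_tail_def by blast
      have nd: "r = s" if "{d, r} \<in> E" "{d, s} \<in> E" "r \<noteq> p" "s \<noteq> p" for r s
        using t that unfolding one_tail_def by blast
      have W: "?W \<subseteq> V" "card ?W = 4"
        using k inV[of x y] inV[of a x] inV[of b x] by (auto simp: kite_def insert_commute)
      have "d \<in> V - ?W" using pd inV[of p d] by blast
      \<comment> \<open>A kite cut off here would contain \<open>d\<close>, the only outside vertex
        joined to \<open>?W\<close>. But \<open>d\<close> keeps at most one neighbour, and a vertex
        of a kite needs two.\<close>
      moreover have "\<not> closed_in (delete E ?W) {x', y', a', b'}" if k': "kite (delete E ?W) x' y' a' b'" for x' y' a' b'
      proof
        assume c: "closed_in (delete E ?W) {x', y', a', b'}"
        have nc: "\<not> closed_in E {x', y', a', b'}" using kopen kite_del[OF k'] by blast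
        obtain v u r s where *: "v \<in> {x', y', a', b'}" "u \<in> ?W" "{v, u} \<in> E" "v \<notin> ?W" "r \<noteq> s"
          "{v, r} \<in> E" "{v, s} \<in> E" "r \<notin> ?W" "s \<notin> ?W" by (rule leaving[OF k' c nc])
        have "v = d" using nW[OF *(2) sym[OF *(3)]] *(4) by blast
        moreover have "r \<noteq> p" "s \<noteq> p" using *(8,9) pd(1) by auto
        ultimately show False using nd[of r s] *(5-7) by blast
      qed
      ultimately have ih: "2 * card (delete E ?W) + 3 \<le> 3 * card (V - ?W)"
        using W by (intro IH) auto
      have L: "{v, t} \<in> set ([{x, y}, {x, a}, {x, b}, {y, a}, {y, b}] @ [{p, d}])" if "v \<in> ?W" "{v, t} \<in> E" for v t
        using nW[OF that]
      proof
        assume "t \<in> ?W"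
        from kite_inner[OF k that(1) this that(2)] show ?thesis unfolding set_append by (rule UnI1)
      qed simp
      show ?thesis
        by (rule reduce[OF L W(1) _ ih]) (simp_all add: W)
    next
      case False
      \<comment> \<open>Every kite now has two tails. Deleting one of them with both tail ends can isolate another
        kite only if the two close up to a ring, which contains a fat theta.\<close>
      have two: "\<exists>u w. two_tail E {x, y, a, b} a u b w" if "kite E x y a b" for x y a b
        using kite_tails[OF that nofan kopen[OF that]] False that by blast
      obtain x y a b where k: "kite E x y a b" using True by blast
      then obtain u w where t: "two_tail E {x, y, a, b} a u b w" using two by blast
      let ?W = "{x, y, a, b}"
      \<comment> \<open>Seven edges meet \<open>?W\<close>, one more than four vertices allow. Each
        of \<open>u\<close> and \<open>w\<close> brings at most one further edge.\<close>
      let ?X = "{x, y, a, b, u, w}"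
      have ds: "distinct [x, y, a, b]" and e: "{x, y} \<in> E" "{x, a} \<in> E" "{x, b} \<in> E" "{y, a} \<in> E" "{y, b} \<in> E"
        using k by (auto simp: kite_def)
      have uw: "u \<notin> ?W" "w \<notin> ?W" "u \<noteq> w" "{a, u} \<in> E" "{b, w} \<in> E" using t by (auto simp: two_tail_def)
      note e = e uw(4,5) e[THEN sym] uw(4,5)[THEN sym]
      have nW: "t \<in> ?W \<or> v = a \<and> t = u \<or> v = b \<and> t = w" if "v \<in> ?W" "{v, t} \<in> E" for v t
        using t that unfolding two_tail_def by blast
      have "r = s" if "{u, r} \<in> E" "{u, s} \<in> E" "r \<noteq> a" "s \<noteq> a" for r s
        using t that unfolding two_tail_def by blast
      then obtain u2 where u2: "\<And>t. {u, t} \<in> E \<Longrightarrow> t = a \<or> t = u2" by metis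
      have "r = s" if "{w, r} \<in> E" "{w, s} \<in> E" "r \<noteq> b" "s \<noteq> b" for r s
        using t that unfolding two_tail_def by blast
      then obtain w2 where w2: "\<And>t. {w, t} \<in> E \<Longrightarrow> t = b \<or> t = w2" by metis
      have X: "?X \<subseteq> V" "card ?X = 6"
        using ds uw inV[of x y] inV[of a u] inV[of b w] e by auto
      \<comment> \<open>The edge would close a third path from \<open>a\<close> to \<open>b\<close>,
        besides those through \<open>x\<close> and \<open>y\<close>.\<close>
      have nuw: "{u, w} \<notin> E"
        using theta[of a b "[x]" "[y]" "[u, w]"] ds uw e by (auto simp: fat_theta_def)
      let ?L = "[{x, y}, {x, a}, {x, b}, {y, a}, {y, b}] @ [{a, u}, {b, w}]"
      have LW: "{v, t} \<in> set ?L" if "v \<in> ?W" "{v, t} \<in> E" for v t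
        using nW[OF that]
      proof
        assume "t \<in> ?W"
        from kite_inner[OF k that(1) this that(2)] show ?thesis unfolding set_append by (rule UnI1)
      qed (elim disjE conjE; simp)
      show ?thesis
      \<comment> \<open>The bound fails for an empty rest. In that case \<open>u\<close> and
        \<open>w\<close> have no further edges, and 7 edges on 6 vertices satisfy 2 * 7 + 3 <=
        18.\<close>
      proof (cases "V - ?X = {}")
        case True
        have "t = a" if "{u, t} \<in> E" for t
        proof -
          have "t \<in> ?X" using True inV[OF that] by blast
          moreover have "t \<noteq> u" using irrefl[OF that] by simp
          ultimately show ?thesis using nW[of t u] sym[OF that] nuw that uw by auto
        qed
        moreover have "t = b" if "{w, t} \<in> E" for t
        proof -
          have "t \<in> ?X" using True inV[OF that] by blast
          moreover have "t \<noteq> w" using irrefl[OF that] by simp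
          ultimately show ?thesis using nW[of t w] sym[OF that] nuw that uw by auto
        qed
        ultimately have "{v, t} \<in> set ?L" if "v \<in> ?X" "{v, t} \<in> E" for v t
        proof -
          from that(1) consider "v \<in> ?W" | "v = u" | "v = w" by blast
          then show ?thesis
          proof cases
            case 1 then show ?thesis using LW that(2) by blast
          next
            case 2
            with that(2) have "t = a" using \<open>\<And>t. {u, t} \<in> E \<Longrightarrow> t = a\<close> by blast
            with 2 show ?thesis by (simp add: insert_commute)
          next
            case 3
            with that(2) have "t = b" using \<open>\<And>t. {w, t} \<in> E \<Longrightarrow> t = b\<close> by blast
            with 3 show ?thesis by (simp add: insert_commute)
          qed
        qed
        then have "card E \<le> card (delete E ?X) + length ?L" by (rule card_del)
        moreover have "card V = 6" using X True by (metis Diff_eq_empty_iff subset_antisym)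
        moreover have "card (delete E ?X) = 0"
        proof -
          have "V \<subseteq> ?X" using True by blast
          from del_V[OF this] show ?thesis by (simp only: card.empty)
        qed
        moreover have "length (?L) = 7" by simp
        ultimately show ?thesis by linarith
      next
        case False
        have out: "u' = u \<or> u' = w" if "{u', v} \<in> E" "u' \<in> ?X" "v \<notin> ?X" for u' v
          using nW[of u' v] that by auto
        have "\<not> closed_in (delete E ?X) {x', y', a', b'}" if k': "kite (delete E ?X) x' y' a' b'" for x' y' a' b'
        proof
          assume c: "closed_in (delete E ?X) {x', y', a', b'}"
          have k'': "kite E x' y' a' b'" and disj: "{x', y', a', b'} \<inter> ?X = {}" using kite_del[OF k'] by auto
          obtain u' w' where t': "two_tail E {x', y', a', b'} a' u' b' w'" using two[OF k''] by blast
          have uw': "u' \<notin> {x', y', a', b'}" "w' \<notin> {x', y', a', b'}" "u' \<noteq> w'" "{a', u'} \<in> E" "{b', w'} \<in> E"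
            using t' by (auto simp: two_tail_def)
          have inX: "z \<in> ?X" if "{v, z} \<in> E" "v \<in> {x', y', a', b'}" "z \<notin> {x', y', a', b'}" for v z
          proof (rule ccontr)
            assume "z \<notin> ?X"
            then have "{v, z} \<in> delete E ?X" using that disj by auto
            from closed_inD[OF c this that(2)] that(3) show False by contradiction
          qed
          have "u' = u \<or> u' = w" "w' = u \<or> w' = w"
            using out[of u' a'] out[of w' b'] inX[of a' u'] inX[of b' w'] uw' sym[of a' u'] sym[of b' w'] disj by auto
          \<comment> \<open>Both kites have their tails in \<open>u\<close> and \<open>w\<close>;
            the two thetas are the two ways of matching these ends with \<open>a'\<close> and
            \<open>b'\<close>.\<close>
          moreover have "\<not> fat_theta E a b [x] [y] [u, a', x', b', w]" "\<not> fat_theta E a b [x] [y] [u, b', x', a', w]"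
            using theta by auto
          ultimately show False
            using k'' ds uw uw' e disj
            by (auto simp: fat_theta_def kite_def insert_commute)
        qed
        then have ih: "2 * card (delete E ?X) + 3 \<le> 3 * card (V - ?X)"
          using X False by (intro IH) auto
        have L: "{v, t} \<in> set (?L @ [{u, u2}, {w, w2}])" if "v \<in> ?X" "{v, t} \<in> E" for v t
        proof -
          from that(1) consider "v \<in> ?W" | "v = u" | "v = w" by blast
          then show ?thesis
          proof cases
            case 1
            from LW[OF 1 that(2)] show ?thesis unfolding set_append[of ?L] by (rule UnI1)
          next
            case 2
            with that(2) u2[of t] have "t = a \<or> t = u2" by blast
            with 2 show ?thesis by (elim disjE) (simp_all add: insert_commute)
          next
            case 3
            with that(2) w2[of t] have "t = b \<or> t = w2" by blast
            with 3 show ?thesis by (elim disjE) (simp_all add: insert_commute)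
          qed
        qed
        show ?thesis
          by (rule reduce[OF L X(1) _ ih]) (simp_all add: X)
      qed
    qed
  next
    case False
    then have nokite: "\<not> kite E x y a b" for x y a b by blast
    have IH': "2 * card (delete E X) + 3 \<le> 3 * card (V - X)" if "V - X \<noteq> {}" "X \<subseteq> V" "X \<noteq> {}" for X
    proof (rule IH[OF that])
      fix x y a b assume "kite (delete E X) x y a b"
      with kite_del[OF this] nokite show "\<not> closed_in (delete E X) {x, y, a, b}" by blast
    qed
    show ?thesis
    proof (cases "\<exists>x y. {x, y} \<in> E \<and> branch E x \<and> branch E y")
      case False
      then show ?thesis using cactus_bound[OF less.prems(1,2)] by blast
    next
      case True
      then obtain x y where xy: "{x, y} \<in> E" "branch E x" "branch E y" by blast
      have other: "\<exists>p q. p \<noteq> q \<and> p \<noteq> z \<and> q \<noteq> z \<and> {v, p} \<in> E \<and> {v, q} \<in> E" if "branch E v" for v z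
        using that unfolding branch_def by (metis distinct_length_2_or_more)
      obtain p q where pq: "p \<noteq> q" "p \<noteq> y" "q \<noteq> y" "{x, p} \<in> E" "{x, q} \<in> E" using other[OF xy(2)] by blast
      obtain r s where rs: "r \<noteq> s" "r \<noteq> x" "s \<noteq> x" "{y, r} \<in> E" "{y, s} \<in> E" using other[OF xy(3)] by blast
      have irr: "p \<noteq> x" "q \<noteq> x" "r \<noteq> y" "s \<noteq> y" "x \<noteq> y" using pq rs xy irrefl by blast+
      \<comment> \<open>Four distinct neighbours would be the leaves of a double star. The shared
        one becomes the apex \<open>a\<close> of a triangle on \<open>{x, y}\<close>, and the
        remaining two become \<open>x'\<close> and \<open>y'\<close>.\<close>
      have "p = r \<or> p = s \<or> q = r \<or> q = s" using s22[of x y p q r s] pq rs irr xy by auto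
      then obtain a x' y' where axy: "{x, a} \<in> E" "{y, a} \<in> E" "{x, x'} \<in> E" "{y, y'} \<in> E"
        "distinct [x, y, a]" "x' \<notin> {x, y, a}" "y' \<notin> {x, y, a}"
        using pq rs irr that by (smt (verit) distinct_length_2_or_more distinct_singleton insert_iff empty_iff)
      note e = xy(1) axy(1-4)
      note e = e e[THEN sym]
      note cx = triangle_corner[OF nokite e(1,2,3,4,5) axy(5,6,7)]
      have d': "distinct [y, x, a]" "y' \<notin> {y, x, a}" "x' \<notin> {y, x, a}" using axy by auto
      note cy = triangle_corner[OF nokite e(6,3,2,5,4) d']
      obtain x'' where x'': "\<And>t. {x', t} \<in> E \<Longrightarrow> t = x \<or> t = x''" using cx(3) by blast
      obtain y'' where y'': "\<And>t. {y', t} \<in> E \<Longrightarrow> t = y \<or> t = y''" using cy(3) by blast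
      show ?thesis
      proof (cases "\<exists>a'. {a, a'} \<in> E \<and> a' \<notin> {x, y, a}")
        case False
        then have na: "t = x \<or> t = y" if "{a, t} \<in> E" for t using that irrefl[OF that] by blast
        \<comment> \<open>At most six edges meet these four vertices, and \<open>y'\<close> stays,
          so the rest is not empty.\<close>
        let ?X = "{x, y, a, x'}"
        have X: "?X \<subseteq> V" "card ?X = 4" using axy e inV by (auto dest: inV)
        have "y' \<in> V - ?X" using axy cx(1) inV[of y y'] by auto
        then have ih: "2 * card (delete E ?X) + 3 \<le> 3 * card (V - ?X)" using X by (intro IH') auto
        have L: "{v, t} \<in> set [{x, y}, {x, a}, {y, a}, {x, x'}, {y, y'}, {x', x''}]" if "v \<in> ?X" "{v, t} \<in> E" for v t
        proof -
          from that(1) consider "v = x" | "v = y" | "v = a" | "v = x'" by blast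
          then show ?thesis
          proof cases
            case 1 show ?thesis using cx(2)[OF that(2)[unfolded 1]] 1
              by (elim disjE) (simp_all add: insert_commute)
          next
            case 2 show ?thesis using cy(2)[OF that(2)[unfolded 2]] 2
              by (elim disjE) (simp_all add: insert_commute)
          next
            case 3 show ?thesis using na[OF that(2)[unfolded 3]] 3
              by (elim disjE) (simp_all add: insert_commute)
          next
            case 4 show ?thesis using x''[OF that(2)[unfolded 4]] 4
              by (elim disjE) (simp_all add: insert_commute)
          qed
        qed
        show ?thesis by (rule reduce[OF L X(1) _ ih]) (simp_all add: X)
      next
        case True
        then obtain a' where a': "{a, a'} \<in> E" "a' \<notin> {x, y, a}" by blast
        have d'': "distinct [a, x, y]" "a' \<notin> {a, x, y}" "x' \<notin> {a, x, y}" "y' \<notin> {a, x, y}" "distinct [a, y, x]"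
            "a' \<notin> {a, y, x}" "y' \<notin> {a, y, x}"
          using axy a' by auto
        note ca = triangle_corner[OF nokite e(7) e(8) e(1) a'(1) e(4) d''(1,2,3)]
        have ay: "a' \<noteq> y'" by (rule triangle_corner(1)[OF nokite e(8) e(7) e(6) a'(1) e(5) d''(5,6,7)])
        obtain a'' where a'': "\<And>t. {a', t} \<in> E \<Longrightarrow> t = a \<or> t = a''" using ca(3) by blast
        \<comment> \<open>With the extra edge at \<open>a\<close>, the triangle and
          \<open>x'\<close> could meet seven edges. Taking all three outer neighbours gives at most
          nine edges on six vertices.\<close>
        let ?X = "{x, y, a, x', y', a'}"
        have X: "?X \<subseteq> V" "card ?X = 6"
          using axy a' cx(1) ca(1) ay inV[OF xy(1)] inV[OF a'(1)] inV[of x x'] inV[of y y'] by auto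
        let ?T = "[{x, y}, {x, a}, {y, a}, {x, x'}, {y, y'}, {a, a'}]"
        have T: "{v, t} \<in> set ?T" if "v \<in> {x, y, a}" "{v, t} \<in> E" for v t
        proof -
          from that(1) consider "v = x" | "v = y" | "v = a" by blast
          then show ?thesis
          proof cases
            case 1 show ?thesis using cx(2)[OF that(2)[unfolded 1]] 1
              by (elim disjE) (simp_all add: insert_commute)
          next
            case 2 show ?thesis using cy(2)[OF that(2)[unfolded 2]] 2
              by (elim disjE) (simp_all add: insert_commute)
          next
            case 3 show ?thesis using ca(2)[OF that(2)[unfolded 3]] 3
              by (elim disjE) (simp_all add: insert_commute)
          qed
        qed
        show ?thesis
        proof (cases "V - ?X = {}")
          case False
          then have ih: "2 * card (delete E ?X) + 3 \<le> 3 * card (V - ?X)" using X by (intro IH') auto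
          have L: "{v, t} \<in> set (?T @ [{x', x''}, {y', y''}, {a', a''}])" if "v \<in> ?X" "{v, t} \<in> E" for v t
          proof -
            from that(1) consider "v \<in> {x, y, a}" | "v = x'" | "v = y'" | "v = a'" by blast
            then show ?thesis
            proof cases
              case 1
              from T[OF 1 that(2)] show ?thesis unfolding set_append[of ?T] by (rule UnI1)
            next
              case 2 show ?thesis using x''[OF that(2)[unfolded 2]] 2
                by (elim disjE) (simp_all add: insert_commute)
            next
              case 3 show ?thesis using y''[OF that(2)[unfolded 3]] 3
                by (elim disjE) (simp_all add: insert_commute)
            next
              case 4 show ?thesis using a''[OF that(2)[unfolded 4]] 4
                by (elim disjE) (simp_all add: insert_commute)
            qed
          qed
          show ?thesis by (rule reduce[OF L X(1) _ ih]) (simp_all add: X)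
        next
          case True
          let ?N = "[{x', y'}, {x', a'}, {y', a'}]"
          have outer: "{v, t} \<in> set ?T \<or> {v, t} \<in> set ?N" if "v \<in> {x', y', a'}" "{v, t} \<in> E" for v t
          proof (cases "t \<in> {x, y, a}")
            case True
            then show ?thesis using T[of t v] sym[OF that(2)] by (metis insert_commute)
          next
            case False
            then have "t \<in> {x', y', a'}" using \<open>V - ?X = {}\<close> inV[OF that(2)] by blast
            with that(1) irrefl[OF that(2)] show ?thesis
              by (elim insertE emptyE) (simp_all add: insert_commute)
          qed
          have ne: "x' \<notin> {x, y, a}" "y' \<notin> {x, y, a}" "a' \<notin> {x, y, a}" using axy a' by auto
          \<comment> \<open>Any two of these edges share a vertex that is also joined to the
            triangle, and its degree is at most 2. So at most one of them exists, and again at most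
            7 edges lie on 6 vertices.\<close>
          have "\<exists>f. \<forall>g\<in>set ?N. g \<in> E \<longrightarrow> g = f"
          proof -
            have "\<not> ({x', y'} \<in> E \<and> {x', a'} \<in> E)" using x''[of y'] x''[of a'] ay ne by auto
            moreover have "\<not> ({x', y'} \<in> E \<and> {y', a'} \<in> E)"
              using y''[of x'] y''[of a'] ca(1) ne sym[of x' y'] by auto
            moreover have "\<not> ({x', a'} \<in> E \<and> {y', a'} \<in> E)"
              using a''[of x'] a''[of y'] cx(1) ne sym[of x' a'] sym[of y' a'] by auto
            ultimately show ?thesis by auto
          qed
          then obtain f where f: "\<And>g. g \<in> set ?N \<Longrightarrow> g \<in> E \<Longrightarrow> g = f" by blast
          have "{v, t} \<in> set (?T @ [f])" if "v \<in> ?X" "{v, t} \<in> E" for v t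
          proof (cases "v \<in> {x, y, a}")
            case True
            from T[OF this that(2)] show ?thesis unfolding set_append by (rule UnI1)
          next
            case False
            then have "v \<in> {x', y', a'}" using that by blast
            from outer[OF this that(2)] show ?thesis
            proof
              assume "{v, t} \<in> set ?T"
              then show ?thesis unfolding set_append by (rule UnI1)
            next
              assume "{v, t} \<in> set ?N"
              from f[OF this that(2)] show ?thesis by simp
            qed
          qed
          then have "card E \<le> card (delete E ?X) + length (?T @ [f])" by (rule card_del)
          moreover have "card V = 6" using X True by (metis Diff_eq_empty_iff subset_antisym)
          moreover have "card (delete E ?X) = 0"
          proof -
            have "V \<subseteq> ?X" using True by blast
            from del_V[OF this] show ?thesis by (simp only: card.empty)
          qed
          moreover have "length (?T @ [f]) = 7" by simp
          ultimately show ?thesis by linarith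
        qed
      qed
    qed
  qed
qed

text \<open>Compare the values of 2e - 3n, which add up over disjoint parts: -2 for a kite, -1 for a
  fan, at most -3 for a part covered by the bound. The sum exceeds -3 only for one kite, one fan or
  two fans; three fans, or a fan with a kite, give exactly -3.\<close>

lemma edge_bound:
  assumes "sparse V E" "V \<noteq> {}"
  shows "2 * card E + 3 \<le> 3 * card V \<or> card V = 4 \<and> card E \<le> 5 \<or>
    card V = 5 \<and> card E \<le> 7 \<or> card V = 10 \<and> card E \<le> 14"
  using assms
proof (induction "card V" arbitrary: V E rule: less_induct)
  case less
  interpret sparse V E by fact
  have step: ?case if W: "W \<subseteq> V" "W \<noteq> {}" "closed_in E W"
    and L: "\<And>v t. \<lbrakk>v \<in> W; t \<in> W; {v, t} \<in> E\<rbrakk> \<Longrightarrow> {v, t} \<in> set L"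
    and c: "card W = 4 \<and> length L = 5 \<or> card W = 5 \<and> length L = 7" for W L
  proof -
    have e: "card E \<le> card (delete E W) + length L"
      by (rule card_del) (use L closed_inD[OF W(3)] in blast)
    have v: "card V = card (V - W) + card W" using card_V_del[OF W(1)] .
    show ?thesis
    proof (cases "V - W = {}")
      case True
      then have "V \<subseteq> W" by blast
      from del_V[OF this] have "card (delete E W) = 0" by (simp only: card.empty)
      moreover have "card (V - W) = 0" using True by (simp only: card.empty)
      ultimately show ?thesis using c e v by linarith
    next
      case False
      have "card (V - W) < card V" using W fin by (intro psubset_card_mono) auto
      from less.hyps[OF this restrict False] show ?thesis using e v c by (elim disjE) linarith+
    qed
  qed
  show ?case
  proof (cases "\<exists>c p q r s. fan E c p q r s")
    case True
    then obtain c p q r s where f: "fan E c p q r s" by blast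
    show ?thesis
    proof (rule step[OF _ _ fan_closed[OF f] fan_inner[OF f]])
      show "{c, p, q, r, s} \<subseteq> V" using f unfolding fan_def by (meson empty_subsetI inV insert_subset)
      show "card {c, p, q, r, s} = 4 \<and> length [{c, p}, {c, q}, {c, r}, {c, s}, {p, q}, {q, r}, {r, s}] = 5 \<or>
        card {c, p, q, r, s} = 5 \<and> length [{c, p}, {c, q}, {c, r}, {c, s}, {p, q}, {q, r}, {r, s}] = 7"
        using f by (auto simp: fan_def)
    qed auto
  next
    case nofan: False
    show ?thesis
    proof (cases "\<exists>x y a b. kite E x y a b \<and> closed_in E {x, y, a, b}")
      case True
      then obtain x y a b where k: "kite E x y a b" "closed_in E {x, y, a, b}" by blast
      show ?thesis
      proof (rule step[OF _ _ k(2) kite_inner[OF k(1)]])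
        show "{x, y, a, b} \<subseteq> V" using k(1) unfolding kite_def by (meson empty_subsetI inV insert_subset)
        show "card {x, y, a, b} = 4 \<and> length [{x, y}, {x, a}, {x, b}, {y, a}, {y, b}] = 5 \<or>
          card {x, y, a, b} = 5 \<and> length [{x, y}, {x, a}, {x, b}, {y, a}, {y, b}] = 7"
          using k by (auto simp: kite_def)
      qed auto
    next
      case False
      then show ?thesis using no_closed_component_bound[OF less.prems] nofan by blast
    qed
  qed
qed

section \<open>Outerplanar drawings\<close>

lemma two_arcs_loop:
  assumes "arc c1" "pathstart c1 = a" "pathfinish c1 = b"
    and "arc c2" "pathstart c2 = a" "pathfinish c2 = b"
    and "path_image c1 \<inter> path_image c2 = {a, b}"
  obtains c where "simple_path c" "pathfinish c = pathstart c"
    "path_image c = path_image c1 \<union> path_image c2"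
proof
  show "simple_path (c1 +++ reversepath c2)"
    using assms by (intro simple_path_join_loop) (auto simp: arc_reversepath)
qed (use assms in \<open>auto simp: path_image_join\<close>)

text \<open>If the third arc is not inside the curve of the first two, a point \<open>p\<close>
  inside that curve also lies inside one of the other two curves. The larger of the two regions then
  contains the arc that bounds only the smaller one.\<close>

lemma theta_inside:
  fixes a b :: complex
  assumes arcs: "arc c1" "pathstart c1 = a" "pathfinish c1 = b"
      "arc c2" "pathstart c2 = a" "pathfinish c2 = b"
      "arc c3" "pathstart c3 = a" "pathfinish c3 = b"
    and I: "path_image c1 \<inter> path_image c2 = {a, b}" "path_image c1 \<inter> path_image c3 = {a, b}"
      "path_image c2 \<inter> path_image c3 = {a, b}"
  shows "path_image c1 - {a, b} \<subseteq> inside (path_image c2 \<union> path_image c3) \<or>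
    path_image c2 - {a, b} \<subseteq> inside (path_image c1 \<union> path_image c3) \<or>
    path_image c3 - {a, b} \<subseteq> inside (path_image c1 \<union> path_image c2)"
proof -
  let ?A = "path_image c1" and ?B = "path_image c2" and ?C = "path_image c3"
  have J: "\<exists>c. simple_path c \<and> pathfinish c = pathstart c \<and> path_image c = path_image g \<union> path_image h"
    if "arc g" "pathstart g = a" "pathfinish g = b" "arc h" "pathstart h = a" "pathfinish h = b"
      "path_image g \<inter> path_image h = {a, b}" for g h :: "real \<Rightarrow> complex"
    using two_arcs_loop[OF that] by blast
  have interior: "path_image h - {a, b} \<subseteq> inside S \<or> (path_image h - {a, b}) \<inter> inside S = {}"
    if h: "arc h" "pathstart h = a" "pathfinish h = b" and "path_image h \<inter> S = {a, b}" "closed S"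
    for h :: "real \<Rightarrow> complex" and S
  proof -
    have c: "connected (path_image h - {a, b})"
      using connected_simple_path_endless[of h] h by (simp add: arc_imp_simple_path)
    have "path_image h - {a, b} \<subseteq> inside S \<union> outside S"
      using that by (auto simp: inside_Un_outside)
    moreover have "open (inside S)" "open (outside S)"
      using that by (auto intro: open_inside open_outside)
    moreover have "inside S \<inter> outside S \<inter> (path_image h - {a, b}) = {}"
      using inside_Int_outside[of S] by blast
    ultimately have "inside S \<inter> (path_image h - {a, b}) = {} \<or> outside S \<inter> (path_image h - {a, b}) = {}"
      by (intro connectedD[OF c]) auto
    with \<open>path_image h - {a, b} \<subseteq> inside S \<union> outside S\<close> show ?thesis by blast
  qed
  have cmp: "compact ?A" "compact ?B" "compact ?C"
    using arcs by (auto intro: compact_arc_image)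
  have step: "path_image h - {a, b} \<subseteq> inside (path_image f \<union> path_image g)"
    if f: "arc f" "pathstart f = a" "pathfinish f = b" and g: "arc g" "pathstart g = a" "pathfinish g = b"
      and h: "arc h" "pathstart h = a" "pathfinish h = b"
      and fg: "path_image f \<inter> path_image g = {a, b}" and fh: "path_image f \<inter> path_image h = {a, b}"
      and gh: "path_image g \<inter> path_image h = {a, b}"
      and p: "p \<in> inside (path_image f \<union> path_image h)" "p \<in> inside (path_image f \<union> path_image g)"
      and out: "(path_image g - {a, b}) \<inter> inside (path_image f \<union> path_image h) = {}"
    for f g h :: "real \<Rightarrow> complex" and p
  proof -
    let ?F = "path_image f" and ?G = "path_image g" and ?H = "path_image h"
    obtain c where c: "simple_path c" "pathfinish c = pathstart c" "path_image c = ?F \<union> ?H"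
      using J[OF f h fh] by blast
    obtain d where d: "simple_path d" "pathfinish d = pathstart d" "path_image d = ?F \<union> ?G"
      using J[OF f g fg] by blast
    note jc = Jordan_inside_outside[OF c(1,2), unfolded c(3)]
    note jd = Jordan_inside_outside[OF d(1,2), unfolded d(3)]
    \<comment> \<open>A connected region that avoids the second curve lies on one side of it, and
      \<open>p\<close> selects the inside. Then \<open>?H\<close>, as part of the boundary of the
      smaller region, lies in the closure of the larger one.\<close>
    have "inside (?F \<union> ?H) \<inter> (?F \<union> ?G) = {}"
      using out fg inside_no_overlap[of "?F \<union> ?H"] by blast
    then have "inside (?F \<union> ?H) \<subseteq> inside (?F \<union> ?G) \<union> outside (?F \<union> ?G)"
      using jd by blast
    then have "inside (?F \<union> ?G) \<inter> inside (?F \<union> ?H) = {} \<or> outside (?F \<union> ?G) \<inter> inside (?F \<union> ?H) = {}"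
      using jc jd by (intro connectedD) auto
    with p have "inside (?F \<union> ?H) \<subseteq> inside (?F \<union> ?G)"
      using \<open>inside (?F \<union> ?H) \<subseteq> _\<close> by blast
    then have "closure (inside (?F \<union> ?H)) \<subseteq> closure (inside (?F \<union> ?G))" by (rule closure_mono)
    moreover have "?H \<subseteq> closure (inside (?F \<union> ?H))"
      using jc by (auto simp: frontier_def)
    moreover have "closure (inside (?F \<union> ?G)) \<subseteq> inside (?F \<union> ?G) \<union> (?F \<union> ?G)"
      using jd closure_Un_frontier[of "inside (?F \<union> ?G)"] by auto
    ultimately have "?H \<subseteq> inside (?F \<union> ?G) \<union> (?F \<union> ?G)" by blast
    then show ?thesis using fh gh by blast
  qed
  obtain c where c: "simple_path c" "pathfinish c = pathstart c" "path_image c = ?A \<union> ?B"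
    using J[OF arcs(1-6) I(1)] by blast
  note j = Jordan_inside_outside[OF c(1,2), unfolded c(3)]
  show ?thesis
  proof (cases "?C - {a, b} \<subseteq> inside (?A \<union> ?B)")
    case False
    have "?C \<inter> (?A \<union> ?B) = {a, b}" using I by blast
    then have out: "(?C - {a, b}) \<inter> inside (?A \<union> ?B) = {}"
      using interior[OF arcs(7-9), of "?A \<union> ?B"] False cmp by (auto simp: compact_imp_closed closed_Un)
    obtain p where p: "p \<in> inside (?A \<union> ?B)" using j by blast
    have pC: "p \<notin> ?A \<union> ?B \<union> ?C"
      using p out inside_no_overlap[of "?A \<union> ?B"] I by blast
    \<comment> \<open>Otherwise \<open>p\<close> is joined to a far point \<open>u\<close> off each
      of the two curves. These meet exactly in the connected set \<open>?C\<close>, so by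
      Janiszewski \<open>p\<close> and \<open>u\<close> are joined off all three arcs, although
      \<open>p\<close> is inside \<open>?A \<union> ?B\<close>.\<close>
    have "p \<in> inside (?A \<union> ?C) \<or> p \<in> inside (?B \<union> ?C)"
    proof (rule ccontr)
      assume "\<not> ?thesis"
      then have o: "p \<in> outside (?A \<union> ?C)" "p \<in> outside (?B \<union> ?C)"
        using pC by (auto simp: inside_eq_outside inside_outside)
      have "bounded (?A \<union> ?B \<union> ?C)" using cmp by (auto simp: compact_imp_bounded)
      then have "outside (?A \<union> ?B \<union> ?C) \<noteq> {}" by (intro outside_bounded_nonempty)
      then obtain u where u: "u \<in> outside (?A \<union> ?B \<union> ?C)" by blast
      have cc: "connected_component (- S) p u" if "p \<in> outside S" "S \<subseteq> ?A \<union> ?B \<union> ?C" for S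
      proof -
        have "bounded S" using \<open>bounded (?A \<union> ?B \<union> ?C)\<close> that(2) by (rule bounded_subset)
        then have "connected (outside S)" by (intro connected_outside) auto
        moreover have "u \<in> outside S" using u outside_mono[OF that(2)] by blast
        moreover have "outside S \<subseteq> - S" using outside_no_overlap[of S] by blast
        ultimately show ?thesis using that(1) unfolding connected_component_def by blast
      qed
      have "connected_component (- ((?A \<union> ?C) \<union> (?B \<union> ?C))) p u"
      proof (rule Janiszewski)
        show "compact (?A \<union> ?C)" "closed (?B \<union> ?C)"
          using cmp by (auto simp: compact_Un compact_imp_closed closed_Un)
        have "(?A \<union> ?C) \<inter> (?B \<union> ?C) = ?C" using I by blast
        then show "connected ((?A \<union> ?C) \<inter> (?B \<union> ?C))"
          using arcs by (simp add: connected_arc_image)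
        show "connected_component (- (?A \<union> ?C)) p u" by (rule cc) (use o in auto)
        show "connected_component (- (?B \<union> ?C)) p u" by (rule cc) (use o in auto)
      qed
      moreover have "- ((?A \<union> ?C) \<union> (?B \<union> ?C)) \<subseteq> - (?A \<union> ?B)" by blast
      ultimately have "connected_component (- (?A \<union> ?B)) p u"
        using connected_component_of_subset by blast
      then have "p \<in> outside (?A \<union> ?B)"
        using outside_same_component u outside_mono[of "?A \<union> ?B" "?A \<union> ?B \<union> ?C"]
        by (metis (no_types, lifting) Un_upper1 connected_component_sym subsetD)
      then show False using p inside_Int_outside by blast
    qed
    then show ?thesis
    proof
      assume "p \<in> inside (?A \<union> ?C)"
      then have "?B - {a, b} \<subseteq> inside (?A \<union> ?C)"
        by (rule step[OF arcs(1-3) arcs(7-9) arcs(4-6), rotated 4]) (use I p out in auto)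
      then show ?thesis by blast
    next
      assume "p \<in> inside (?B \<union> ?C)"
      then have "?A - {a, b} \<subseteq> inside (?B \<union> ?C)"
        by (rule step[OF arcs(4-6) arcs(7-9) arcs(1-3), rotated 4]) (use I p out in \<open>auto simp: Un_commute\<close>)
      then show ?thesis by blast
    qed
  qed auto
qed

text \<open>Recovers the ends of a chord as limit points when only the open chord is known to lie in
  a region.\<close>

lemma arc_subset_closure_endless:
  fixes g :: "real \<Rightarrow> 'a::t2_space"
  assumes "arc g"
  shows "path_image g \<subseteq> closure (path_image g - {pathstart g, pathfinish g})"
proof -
  have "g ` closure {0<..<1} \<subseteq> closure (path_image g - {pathstart g, pathfinish g})"
  proof (rule image_closure_subset)
    show "continuous_on (closure {0<..<1}) g"
      using arc_imp_path[OF assms] by (simp add: path_def)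
    show "g ` {0<..<1} \<subseteq> closure (path_image g - {pathstart g, pathfinish g})"
      using simple_path_endless[OF arc_imp_simple_path[OF assms]] closure_subset by metis
  qed simp
  then show ?thesis by (simp add: path_image_def)
qed

section \<open>Paths of the graph as arcs of the drawing\<close>

fun walk_edges :: "'a list \<Rightarrow> 'a set set" where
  "walk_edges (x # y # p) = insert {x, y} (walk_edges (y # p))"
| "walk_edges _ = {}"

lemma walk_edges_subset: "walk E p \<longleftrightarrow> walk_edges p \<subseteq> E"
  by (induction p rule: walk_edges.induct) auto

lemma Union_walk_edges: "\<Union>(walk_edges (x # P @ [y])) = set (x # P @ [y])"
  by (induction P arbitrary: x) auto

lemma walk_edges_interior: "e \<in> walk_edges (x # P @ [y]) \<Longrightarrow> P \<noteq> [] \<Longrightarrow> e \<inter> set P \<noteq> {}"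
proof (induction P arbitrary: x)
  case (Cons p P)
  then show ?case by (cases P) auto
qed simp

text \<open>Edges carry no direction, so an edge arc may have to be reversed before joining. The
  later edges avoid \<open>x\<close>, hence meet the first one only in the point of its other end,
  and the join is again an arc.\<close>

lemma walk_arc:
  assumes emb: "planar_embedding G \<phi> \<gamma>"
    and "walk (edges G) (x # P @ [y])" "distinct (x # P @ [y])"
  shows "\<exists>g. arc g \<and> pathstart g = \<phi> x \<and> pathfinish g = \<phi> y \<and>
    path_image g = (\<Union>e\<in>walk_edges (x # P @ [y]). path_image (\<gamma> e))"
  using assms(2,3)
proof (induction P arbitrary: x)
  have single: "\<exists>g. arc g \<and> pathstart g = \<phi> x \<and> pathfinish g = \<phi> y \<and> path_image g = path_image (\<gamma> {x, y})"
    if e: "{x, y} \<in> edges G" and "x \<noteq> y" for x y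
  proof -
    have a: "arc (\<gamma> {x, y})" and ends: "{pathstart (\<gamma> {x, y}), pathfinish (\<gamma> {x, y})} = {\<phi> x, \<phi> y}"
      using emb e by (auto simp: planar_embedding_def)
    then consider "pathstart (\<gamma> {x, y}) = \<phi> x" "pathfinish (\<gamma> {x, y}) = \<phi> y"
      | "pathstart (\<gamma> {x, y}) = \<phi> y" "pathfinish (\<gamma> {x, y}) = \<phi> x"
      by (auto simp: doubleton_eq_iff)
    then show ?thesis
    proof cases
      case 1 then show ?thesis using a by blast
    next
      case 2 then show ?thesis using a
        by (intro exI[of _ "reversepath (\<gamma> {x, y})"]) (auto simp: arc_reversepath)
    qed
  qed
  {
    case Nil
    then obtain g where "arc g" "pathstart g = \<phi> x" "pathfinish g = \<phi> y" "path_image g = path_image (\<gamma> {x, y})"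
      using single[of x y] by auto
    then show ?case by auto
  next
    case (Cons p P)
    then have xp: "{x, p} \<in> edges G" "x \<noteq> p" by auto
    obtain g where g: "arc g" "pathstart g = \<phi> p" "pathfinish g = \<phi> y"
      "path_image g = (\<Union>e\<in>walk_edges (p # P @ [y]). path_image (\<gamma> e))"
      using Cons.IH[of p] Cons.prems by auto
    obtain h where h: "arc h" "pathstart h = \<phi> x" "pathfinish h = \<phi> p" "path_image h = path_image (\<gamma> {x, p})"
      using single[OF xp] by blast
    have "path_image (\<gamma> {x, p}) \<inter> path_image (\<gamma> e) \<subseteq> {\<phi> p}" if e: "e \<in> walk_edges (p # P @ [y])" for e
    proof -
      have "x \<notin> e" using e Union_walk_edges[of p P y] Cons.prems by auto
      then have "{x, p} \<noteq> e" "\<phi> ` ({x, p} \<inter> e) \<subseteq> {\<phi> p}" by auto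
      moreover have "e \<in> edges G" using e Cons.prems walk_edges_subset[of "edges G" "p # P @ [y]"] by auto
      ultimately show ?thesis using emb xp(1) unfolding planar_embedding_def by metis
    qed
    then have "path_image h \<inter> path_image g \<subseteq> {\<phi> p}" using g h by blast
    then have "arc (h +++ g)" using g h by (intro arc_join) auto
    moreover have "path_image (h +++ g) = (\<Union>e\<in>walk_edges (x # (p # P) @ [y]). path_image (\<gamma> e))"
      using g h by (simp add: path_image_join)
    ultimately show ?case using g h by (intro exI[of _ "h +++ g"]) auto
  }
qed

locale outer_drawing =
  fixes G :: "'a graph" and \<phi> \<gamma> F
  assumes emb: "planar_embedding G \<phi> \<gamma>"
    and F: "F \<in> components (- drawing G \<phi> \<gamma>)" "\<not> bounded F" "\<phi> ` verts G \<subseteq> frontier F"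
    and edge_verts: "e \<in> edges G \<Longrightarrow> e \<subseteq> verts G"
begin

definition path_arc :: "'a \<Rightarrow> 'a list \<Rightarrow> 'a \<Rightarrow> real \<Rightarrow> complex" where
  "path_arc x P y = (SOME g. arc g \<and> pathstart g = \<phi> x \<and> pathfinish g = \<phi> y \<and>
    path_image g = (\<Union>e\<in>walk_edges (x # P @ [y]). path_image (\<gamma> e)))"

lemma path_arc:
  assumes "walk (edges G) (x # P @ [y])" "distinct (x # P @ [y])"
  shows "arc (path_arc x P y)" "pathstart (path_arc x P y) = \<phi> x" "pathfinish (path_arc x P y) = \<phi> y"
    "path_image (path_arc x P y) = (\<Union>e\<in>walk_edges (x # P @ [y]). path_image (\<gamma> e))"
  using someI_ex[OF walk_arc[OF emb assms]] unfolding path_arc_def by blast+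

lemma walk_verts:
  assumes "walk (edges G) (x # P @ [y])"
  shows "set (x # P @ [y]) \<subseteq> verts G"
  using assms edge_verts unfolding walk_edges_subset Union_walk_edges[symmetric] by blast

text \<open>The unbounded face is connected and misses \<open>S\<close>, so it misses
  \<open>inside S\<close>. As that set is open, it also misses the closure of the face, where every
  vertex lies.\<close>

lemma vertex_not_inside:
  assumes "S \<subseteq> drawing G \<phi> \<gamma>" "v \<in> verts G" "closed S"
  shows "\<phi> v \<notin> inside S"
proof
  assume v: "\<phi> v \<in> inside S"
  have "F \<inter> inside S = {}"
  proof (rule ccontr)
    assume "F \<inter> inside S \<noteq> {}"
    then obtain z where z: "z \<in> F" "z \<in> inside S" by blast
    have "F \<subseteq> - S" "connected F"
      using F(1) assms(1) in_components_subset in_components_connected by blast+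
    then have "F \<subseteq> connected_component_set (- S) z"
      using z(1) by (intro connected_component_maximal)
    then have "bounded F" using z(2) bounded_subset unfolding inside_def by blast
    then show False using F(2) by blast
  qed
  moreover have "open (inside S)" using assms(3) by (rule open_inside)
  ultimately have "closure F \<inter> inside S = {}" by (metis Int_commute open_Int_closure_eq_empty)
  then show False using v assms(2) F(3) by (auto simp: frontier_def)
qed

lemma path_image_sub:
  assumes "walk (edges G) (x # P @ [y])" "distinct (x # P @ [y])"
  shows "path_image (path_arc x P y) \<subseteq> drawing G \<phi> \<gamma>"
  using path_arc(4)[OF assms] assms(1) unfolding walk_edges_subset drawing_def by auto

lemma vertex_on_path:
  assumes "walk (edges G) (x # P @ [y])" "distinct (x # P @ [y])" "v \<in> verts G"
  shows "\<phi> v \<in> path_image (path_arc x P y) \<longleftrightarrow> v \<in> set (x # P @ [y])"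
proof -
  have "\<phi> v \<in> path_image (\<gamma> e) \<longleftrightarrow> v \<in> e" if "e \<in> walk_edges (x # P @ [y])" for e
  proof -
    have e: "e \<in> edges G" using that assms(1) unfolding walk_edges_subset by blast
    have "path_image (\<gamma> e) \<inter> \<phi> ` verts G = \<phi> ` e" "inj_on \<phi> (verts G)"
      using emb e by (auto simp: planar_embedding_def)
    then show ?thesis using assms(3) edge_verts[OF e]
      by (smt (verit) Int_iff image_iff inj_on_eq_iff subsetD)
  qed
  then show ?thesis
    unfolding path_arc(4)[OF assms(1,2)] Union_walk_edges[symmetric] by blast
qed

text \<open>Each edge of the second path contains a vertex of \<open>Q\<close>, so it is not an edge
  of the first path. \<open>P\<close> may be empty, which admits a single edge as a chord.\<close>

lemma paths_meet:
  assumes "walk (edges G) (x # P @ [y])" "walk (edges G) (x # Q @ [y])"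
    and "distinct (x # y # P @ Q)" "Q \<noteq> []"
  shows "path_image (path_arc x P y) \<inter> path_image (path_arc x Q y) = {\<phi> x, \<phi> y}"
proof
  have d: "distinct (x # P @ [y])" "distinct (x # Q @ [y])" using assms by auto
  show "{\<phi> x, \<phi> y} \<subseteq> path_image (path_arc x P y) \<inter> path_image (path_arc x Q y)"
    using path_arc(2,3)[OF assms(1) d(1)] path_arc(2,3)[OF assms(2) d(2)]
      pathstart_in_path_image pathfinish_in_path_image by (metis Int_iff insert_subset empty_subsetI)
  have "path_image (\<gamma> e) \<inter> path_image (\<gamma> f) \<subseteq> {\<phi> x, \<phi> y}"
    if e: "e \<in> walk_edges (x # P @ [y])" and f: "f \<in> walk_edges (x # Q @ [y])" for e f
  proof -
    have "e \<subseteq> set (x # P @ [y])" "f \<subseteq> set (x # Q @ [y])"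
      unfolding Union_walk_edges[symmetric] using e f by blast+
    moreover have "f \<inter> set Q \<noteq> {}" using walk_edges_interior[OF f assms(4)] .
    ultimately have "e \<noteq> f" "\<phi> ` (e \<inter> f) \<subseteq> {\<phi> x, \<phi> y}" using assms(3) by auto
    moreover have "e \<in> edges G" "f \<in> edges G"
      using e f assms(1,2) unfolding walk_edges_subset by blast+
    ultimately show ?thesis using emb unfolding planar_embedding_def by metis
  qed
  then show "path_image (path_arc x P y) \<inter> path_image (path_arc x Q y) \<subseteq> {\<phi> x, \<phi> y}"
    unfolding path_arc(4)[OF assms(1) d(1)] path_arc(4)[OF assms(2) d(2)] by blast
qed

text \<open>One of the three arcs lies inside the curve of the others, and it cannot carry an
  interior vertex. This leaves only \<open>P\<close>. A nonempty \<open>P\<close> is thus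
  contradictory, and an empty one is a chord drawn inside the cycle; the first conclusion excludes
  fat thetas and the second serves for K_4.\<close>

lemma theta_chord_inside:
  assumes w: "walk (edges G) (x # P @ [y])" "walk (edges G) (x # Q @ [y])" "walk (edges G) (x # R @ [y])"
    and d: "distinct (x # y # P @ Q @ R)" and ne: "Q \<noteq> []" "R \<noteq> []"
  shows "P = []" "path_image (path_arc x P y) - {\<phi> x, \<phi> y} \<subseteq>
    inside (path_image (path_arc x Q y) \<union> path_image (path_arc x R y))"
proof -
  have dd: "distinct (x # P @ [y])" "distinct (x # Q @ [y])" "distinct (x # R @ [y])" using d by auto
  note arcs = path_arc(1-3)[OF w(1) dd(1)] path_arc(1-3)[OF w(2) dd(2)] path_arc(1-3)[OF w(3) dd(3)]
  have cl: "closed (path_image (path_arc x P y))" "closed (path_image (path_arc x Q y))"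
    "closed (path_image (path_arc x R y))"
    using arcs by (auto intro: closed_arc_image)
  have no: "\<not> path_image (path_arc x S y) - {\<phi> x, \<phi> y} \<subseteq> inside T"
    if S: "walk (edges G) (x # S @ [y])" "distinct (x # S @ [y])" "S \<noteq> []" and T: "T \<subseteq> drawing G \<phi> \<gamma>" "closed T" for S T
  proof -
    obtain v where v: "v \<in> set S" using S(3) by (cases S) auto
    have sub: "set (x # S @ [y]) \<subseteq> verts G" by (rule walk_verts[OF S(1)])
    then have vG: "v \<in> verts G" using v by auto
    have "v \<noteq> x" "v \<noteq> y" using v S(2) by auto
    then have "\<phi> v \<noteq> \<phi> x" "\<phi> v \<noteq> \<phi> y"
      using emb vG sub unfolding planar_embedding_def by (auto simp: inj_on_eq_iff)
    moreover have "\<phi> v \<in> path_image (path_arc x S y)" using vertex_on_path[OF S(1,2) vG] v by simp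
    ultimately show ?thesis using vertex_not_inside[OF T(1) vG T(2)] by blast
  qed
  note sub = path_image_sub[OF w(1) dd(1)] path_image_sub[OF w(2) dd(2)] path_image_sub[OF w(3) dd(3)]
  have PQ: "path_image (path_arc x P y) \<inter> path_image (path_arc x Q y) = {\<phi> x, \<phi> y}"
    by (rule paths_meet) (use w d ne in auto)
  have PR: "path_image (path_arc x P y) \<inter> path_image (path_arc x R y) = {\<phi> x, \<phi> y}"
    by (rule paths_meet) (use w d ne in auto)
  have QR: "path_image (path_arc x Q y) \<inter> path_image (path_arc x R y) = {\<phi> x, \<phi> y}"
    by (rule paths_meet) (use w d ne in auto)
  show *: "path_image (path_arc x P y) - {\<phi> x, \<phi> y} \<subseteq>
    inside (path_image (path_arc x Q y) \<union> path_image (path_arc x R y))"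
    using theta_inside[OF arcs PQ PR QR] no[OF w(2) dd(2) ne(1)] no[OF w(3) dd(3) ne(2)] sub cl
    by (meson closed_Un Un_least)
  show "P = []"
    using no[OF w(1) dd(1)] * sub cl by (meson closed_Un Un_least)
qed

lemma no_fat_theta: "\<not> fat_theta (edges G) x y P Q R"
  using theta_chord_inside(1)[of x P y Q R] by (auto simp: fat_theta_def)

text \<open>K_4 has too few vertices to contain a fat theta. Instead, both diagonals of the 4-cycle
  \<open>x\<close>, \<open>a\<close>, \<open>y\<close>, \<open>b\<close> are drawn inside it. One of
  them splits the inside, and the disjoint other one cannot connect the two halves.\<close>

lemma no_K4:
  assumes k: "kite (edges G) x y a b" and ab: "{a, b} \<in> edges G"
  shows False
proof -
  have d: "distinct [x, y, a, b]" and e: "{x, y} \<in> edges G" "{x, a} \<in> edges G" "{x, b} \<in> edges G"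
    "{y, a} \<in> edges G" "{y, b} \<in> edges G" using k by (auto simp: kite_def)
  have "{y, x} \<in> edges G" "{a, x} \<in> edges G" "{b, x} \<in> edges G" "{a, y} \<in> edges G" "{b, y} \<in> edges G"
    "{b, a} \<in> edges G" using e ab by (simp_all add: insert_commute)
  note e' = e ab this
  let ?I = "\<lambda>u S v. path_image (path_arc u S v)"
  have V: "x \<in> verts G" "y \<in> verts G" "a \<in> verts G" "b \<in> verts G" using e edge_verts by blast+
  have "{x, y} \<inter> {a, b} = {}" "{x, y} \<noteq> {a, b}" using d by auto
  then have disj: "path_image (\<gamma> {x, y}) \<inter> path_image (\<gamma> {a, b}) = {}"
    using emb e(1) ab unfolding planar_embedding_def by (metis image_empty)
  have xy: "?I x [] y = path_image (\<gamma> {x, y})" and ab': "?I a [] b = path_image (\<gamma> {a, b})"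
    using path_arc(4)[of x "[]" y] path_arc(4)[of a "[]" b] d e ab by auto
  \<comment> \<open>The same 4-cycle arises from the diagonal \<open>{x, y}\<close> and from
    \<open>{a, b}\<close>, so both chords lie in one region \<open>?D\<close>.\<close>
  have same: "?I a [x] b \<union> ?I a [y] b = ?I x [a] y \<union> ?I x [b] y"
    using path_arc(4)[of a "[x]" b] path_arc(4)[of a "[y]" b] path_arc(4)[of x "[a]" y] path_arc(4)[of x "[b]" y] d e'
    by (simp add: insert_commute) blast
  let ?D = "inside (?I x [a] y \<union> ?I x [b] y)"
  have XY: "?I x [] y - {\<phi> x, \<phi> y} \<subseteq> ?D"
    by (rule theta_chord_inside(2)) (use d e' in auto)
  have "?I a [] b - {\<phi> a, \<phi> b} \<subseteq> inside (?I a [x] b \<union> ?I a [y] b)"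
    by (rule theta_chord_inside(2)) (use d e' in auto)
  then have AB: "?I a [] b - {\<phi> a, \<phi> b} \<subseteq> ?D" unfolding same .
  have wk: "walk (edges G) (x # [] @ [y])" "walk (edges G) (x # [a] @ [y])" "walk (edges G) (x # [b] @ [y])"
    "walk (edges G) (a # [] @ [b])"
    and ds: "distinct (x # [] @ [y])" "distinct (x # [a] @ [y])" "distinct (x # [b] @ [y])" "distinct (a # [] @ [b])"
    using d e' by auto
  note A = path_arc(1-3)[OF wk(1) ds(1)] path_arc(1-3)[OF wk(2) ds(2)]
    path_arc(1-3)[OF wk(3) ds(3)] path_arc(1-3)[OF wk(4) ds(4)]
  have ne: "\<phi> x \<noteq> \<phi> y" using emb V d unfolding planar_embedding_def by (auto simp: inj_on_eq_iff)
  have m: "?I x [a] y \<inter> ?I x [b] y = {\<phi> x, \<phi> y}" "?I x [] y \<inter> ?I x [a] y = {\<phi> x, \<phi> y}"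
    "?I x [] y \<inter> ?I x [b] y = {\<phi> x, \<phi> y}"
    by (rule paths_meet; use d e' in auto)+
  have "?I x [] y - {\<phi> x, \<phi> y} \<noteq> {}"
    using nonempty_simple_path_endless[of "path_arc x [] y"] A(1-3) by (simp add: arc_imp_simple_path)
  then have meets: "?I x [] y \<inter> ?D \<noteq> {}" using XY by blast
  let ?D1 = "inside (?I x [a] y \<union> ?I x [] y)" and ?D2 = "inside (?I x [b] y \<union> ?I x [] y)"
  obtain s: "?D1 \<inter> ?D2 = {}" "?D1 \<union> ?D2 \<union> (?I x [] y - {\<phi> x, \<phi> y}) = ?D"
    by (rule split_inside_simple_closed_curve[of "path_arc x [a] y" "\<phi> x" "\<phi> y" "path_arc x [b] y" "path_arc x [] y"])
       (use A ne m meets in \<open>auto simp: arc_imp_simple_path\<close>)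
  let ?J = "?I a [] b - {\<phi> a, \<phi> b}"
  have J: "?J \<subseteq> ?D1 \<union> ?D2" using AB s(2) disj unfolding xy ab' by blast
  have cl: "closed (?I x [a] y \<union> ?I x [] y)" "closed (?I x [b] y \<union> ?I x [] y)"
    using A by (auto intro: closed_arc_image)
  have "connected ?J"
    using connected_simple_path_endless[of "path_arc a [] b"] A(10-12) by (simp add: arc_imp_simple_path)
  then have or: "?D1 \<inter> ?J = {} \<or> ?D2 \<inter> ?J = {}"
    using s(1) J cl by (intro connectedD) (auto intro: open_inside)
  have closJ: "\<phi> a \<in> closure ?J" "\<phi> b \<in> closure ?J"
    using arc_subset_closure_endless[OF A(10)] A(11,12) pathstart_in_path_image[of "path_arc a [] b"]
      pathfinish_in_path_image[of "path_arc a [] b"] by auto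
  \<comment> \<open>If the open chord lies in one half, both its ends lie in the closure of that
    half. The end on the far side is not on the boundary, so it would be a vertex inside a closed
    curve.\<close>
  have no: False if "?J \<subseteq> inside S" "closed S" "S \<subseteq> drawing G \<phi> \<gamma>" "v \<in> {a, b}" "\<phi> v \<notin> S" for S v
  proof -
    have "\<phi> v \<in> closure (inside S)" using closure_mono[OF that(1)] closJ that(4) by blast
    then have "\<phi> v \<in> inside S" using closure_inside_subset[OF that(2)] that(5) by blast
    moreover have "v \<in> verts G" using that(4) V by blast
    ultimately show False using vertex_not_inside[OF that(3) _ that(2)] by blast
  qed
  note sub = path_image_sub[OF wk(1) ds(1)] path_image_sub[OF wk(2) ds(2)] path_image_sub[OF wk(3) ds(3)]
  from or show False
  proof
    assume "?D1 \<inter> ?J = {}"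
    then have "?J \<subseteq> ?D2" using J by blast
    then show False
      by (rule no[OF _ cl(2), of a]) (use sub vertex_on_path[OF wk(1) ds(1) V(3)] vertex_on_path[OF wk(3) ds(3) V(3)] d in auto)
  next
    assume "?D2 \<inter> ?J = {}"
    then have "?J \<subseteq> ?D1" using J by blast
    then show False
      by (rule no[OF _ cl(1), of b]) (use sub vertex_on_path[OF wk(1) ds(1) V(4)] vertex_on_path[OF wk(2) ds(2) V(4)] d in auto)
  qed
qed

end

section \<open>Extremal graphs\<close>

definition parabola :: "real \<Rightarrow> complex" where
  "parabola t = Complex t (t\<^sup>2)"

text \<open>The product is the height of the chord above the parabola. It vanishes only at the two
  ends, so a chord passes through no other vertex, and chords can be compared by their
  heights.\<close>

lemma on_chord:
  assumes "i < j" "z \<in> closed_segment (parabola i) (parabola j)"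
  shows "i \<le> Re z" "Re z \<le> j" "Im z = (Re z)\<^sup>2 + (Re z - i) * (j - Re z)"
proof -
  obtain u where u: "0 \<le> u" "u \<le> 1" "z = (1 - u) *\<^sub>R parabola i + u *\<^sub>R parabola j"
    using assms(2) by (auto simp: in_segment)
  have re: "Re z = i + u * (j - i)" and im: "Im z = (1 - u) * i\<^sup>2 + u * j\<^sup>2"
    by (auto simp: u(3) parabola_def algebra_simps)
  show "i \<le> Re z" using re u assms(1) by simp
  have "u * (j - i) \<le> 1 * (j - i)" using u assms(1) by (intro mult_right_mono) auto
  then show "Re z \<le> j" using re by simp
  show "Im z = (Re z)\<^sup>2 + (Re z - i) * (j - Re z)"
    unfolding re im by (simp add: power2_eq_square algebra_simps)
qed

text \<open>Noncrossing chords are side by side or nested. In the first case they can meet only over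
  a common end; in the second the heights differ by a sum of two nonnegative products, and both
  vanish only at a common end.\<close>

lemma chords_disjoint:
  assumes z: "z \<in> closed_segment (parabola i) (parabola j)" "z \<in> closed_segment (parabola k) (parabola l)"
    and o: "i < j" "k < l" and ne: "(i, j) \<noteq> (k, l)"
    and nc: "\<not> (i < k \<and> k < j \<and> j < l)" "\<not> (k < i \<and> i < l \<and> l < j)"
  shows "z \<in> parabola ` ({i, j} \<inter> {k, l})"
proof -
  note a = on_chord[OF o(1) z(1)] and b = on_chord[OF o(2) z(2)]
  let ?x = "Re z"
  have eq: "(?x - i) * (j - ?x) = (?x - k) * (l - ?x)" using a(3) b(3) by simp
  have nested: "p = r \<and> ?x = p \<or> q = s \<and> ?x = q"
    if "p \<le> r" "s \<le> q" "r \<le> ?x" "?x \<le> s" "(p, q) \<noteq> (r, s)" "(?x - p) * (q - ?x) = (?x - r) * (s - ?x)"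
    for p q r s
  proof -
    have "(?x - p) * (q - ?x) - (?x - r) * (s - ?x) = (r - p) * (q - ?x) + (?x - r) * (q - s)"
      by (simp add: algebra_simps)
    moreover have "0 \<le> (r - p) * (q - ?x)" "0 \<le> (?x - r) * (q - s)" using that by auto
    ultimately have "(r - p) * (q - ?x) = 0" "(?x - r) * (q - s) = 0" using that(6) by linarith+
    then show ?thesis using that by auto
  qed
  have *: "(i = k \<or> i = l) \<and> ?x = i \<or> (j = k \<or> j = l) \<and> ?x = j"
  proof -
    consider "j \<le> k" | "l \<le> i" | "i \<le> k" "l \<le> j" | "k \<le> i" "j \<le> l"
      using nc o by linarith
    then show ?thesis
    proof cases
      case 3
      then show ?thesis using nested[of i k l j] a b ne eq by auto
    next
      case 4
      then show ?thesis using nested[of k i j l] a b ne eq by auto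
    qed (use a b in auto)
  qed
  have "z = parabola i" if "?x = i" using that a(3) by (simp add: parabola_def complex_eq_iff)
  moreover have "z = parabola j" if "?x = j" using that a(3) by (simp add: parabola_def complex_eq_iff)
  ultimately show ?thesis using * by auto
qed

lemma parabola_inj: "parabola s = parabola t \<longleftrightarrow> s = t"
  by (auto simp: parabola_def)

text \<open>The vertices are drawn on a parabola and the edges as chords; the region below
  the parabola then lies in the outer face.\<close>

lemma outerplanar_noncrossing:
  fixes G :: "nat graph"
  assumes fin: "finite (verts G)" and ed: "\<And>e. e \<in> edges G \<Longrightarrow> e \<subseteq> verts G \<and> card e = 2"
    and nc: "\<And>i j k l. \<lbrakk>{i, j} \<in> edges G; {k, l} \<in> edges G; i < k; k < j; j < l\<rbrakk> \<Longrightarrow> False"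
  shows "outerplanar G"
proof -
  define \<phi> where "\<phi> v = parabola (real v)" for v
  define \<gamma> where "\<gamma> e = linepath (\<phi> (Min e)) (\<phi> (Max e))" for e
  have \<phi>_inj: "\<phi> v = \<phi> w \<longleftrightarrow> v = w" for v w by (simp add: \<phi>_def parabola_inj)
  have edge: "\<exists>i j. e = {i, j} \<and> i < j" if "e \<in> edges G" for e
  proof -
    have "card e = 2" using ed[OF that] by blast
    then obtain i j where "e = {i, j}" "i \<noteq> j" by (auto simp: card_2_iff)
    then show ?thesis by (metis insert_commute linorder_neqE_nat)
  qed
  have img: "path_image (\<gamma> {i, j}) = closed_segment (parabola (real i)) (parabola (real j))" if "i < j" for i j
    using that by (simp add: \<gamma>_def \<phi>_def)
  have emb: "planar_embedding G \<phi> \<gamma>"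
    unfolding planar_embedding_def
  proof (intro conjI ballI impI)
    show "inj_on \<phi> (verts G)" by (simp add: inj_on_def \<phi>_inj)
  next
    fix e assume "e \<in> edges G"
    then obtain i j where e: "e = {i, j}" "i < j" using edge by blast
    then show "arc (\<gamma> e)" by (simp add: \<gamma>_def \<phi>_inj arc_linepath)
    show "{pathstart (\<gamma> e), pathfinish (\<gamma> e)} = \<phi> ` e" using e by (simp add: \<gamma>_def)
    have "v = i \<or> v = j" if v: "\<phi> v \<in> path_image (\<gamma> e)" for v
    proof -
      have "\<phi> v \<in> closed_segment (parabola (real i)) (parabola (real j))" using v img e by simp
      from on_chord(3)[OF _ this] e(2) have "(real v - real i) * (real j - real v) = 0"
        by (simp add: \<phi>_def parabola_def)
      then show ?thesis by auto
    qed
    moreover have "\<phi> i \<in> path_image (\<gamma> e)" "\<phi> j \<in> path_image (\<gamma> e)"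
      using e by (auto simp: img \<phi>_def)
    ultimately show "path_image (\<gamma> e) \<inter> \<phi> ` verts G = \<phi> ` e"
      using ed[OF \<open>e \<in> edges G\<close>] e(1) by auto
  next
    fix e f assume ef: "e \<in> edges G" "f \<in> edges G" "e \<noteq> f"
    obtain i j where e: "e = {i, j}" "i < j" using edge ef by blast
    obtain k l where f: "f = {k, l}" "k < l" using edge ef by blast
    have sub: "\<phi> ` (e \<inter> f) \<subseteq> path_image (\<gamma> e) \<inter> path_image (\<gamma> f)"
      using e f by (auto simp: img \<phi>_def)
    have "path_image (\<gamma> e) \<inter> path_image (\<gamma> f) \<subseteq> \<phi> ` (e \<inter> f)"
    proof
      fix z assume "z \<in> path_image (\<gamma> e) \<inter> path_image (\<gamma> f)"
      then have z: "z \<in> closed_segment (parabola (real i)) (parabola (real j))" "z \<in> closed_segment (parabola (real k)) (parabola (real l))"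
        using e f by (simp_all add: img)
      have "z \<in> parabola ` ({real i, real j} \<inter> {real k, real l})"
        by (rule chords_disjoint[OF z]) (use e f ef nc[of i j k l] nc[of k l i j] in auto)
      then show "z \<in> \<phi> ` (e \<inter> f)" using e f by (auto simp: \<phi>_def)
    qed
    with sub show "path_image (\<gamma> e) \<inter> path_image (\<gamma> f) = \<phi> ` (e \<inter> f)" by blast
  qed
  let ?D = "drawing G \<phi> \<gamma>" and ?H = "{z. Im z < (Re z)\<^sup>2}"
  have "?D \<subseteq> {z. (Re z)\<^sup>2 \<le> Im z}"
  proof
    fix z assume "z \<in> ?D"
    then consider v where "z = \<phi> v" | e where "e \<in> edges G" "z \<in> path_image (\<gamma> e)"
      unfolding drawing_def by blast
    then show "z \<in> {z. (Re z)\<^sup>2 \<le> Im z}"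
    proof cases
      case 2
      then obtain i j where e: "e = {i, j}" "i < j" using edge by blast
      then have "z \<in> closed_segment (parabola (real i)) (parabola (real j))" using 2 img by simp
      from on_chord[OF _ this] e show ?thesis by simp
    qed (simp add: \<phi>_def parabola_def)
  qed
  then have H: "?H \<subseteq> - ?D" by force
  define w where "w t = Complex 0 t" for t
  have w: "w (-1) \<in> ?H" by (simp add: w_def)
  have conn: "connected ?H"
  proof -
    \<comment> \<open>A vertical shear flattens the parabola, so the region below it is the image of
      an open half-plane.\<close>
    have "?H = (\<lambda>z. Complex (Re z) (Im z + (Re z)\<^sup>2)) ` {z. Im z < 0}"
    proof (intro equalityI subsetI)
      fix z assume "z \<in> ?H"
      then show "z \<in> (\<lambda>z. Complex (Re z) (Im z + (Re z)\<^sup>2)) ` {z. Im z < 0}"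
        by (intro image_eqI[of _ _ "Complex (Re z) (Im z - (Re z)\<^sup>2)"]) auto
    qed auto
    moreover have "connected {z::complex. Im z < 0}"
      by (intro convex_connected convex_halfspace_Im_lt)
    ultimately show ?thesis
      by (simp only:) (intro connected_continuous_image continuous_intros; simp)
  qed
  let ?F = "connected_component_set (- ?D) (w (-1))"
  have HF: "?H \<subseteq> ?F" using w conn H by (intro connected_component_maximal)
  have "?F \<in> components (- ?D)" using w H by (auto simp: components_def)
  moreover have "\<not> bounded ?F"
  proof
    assume "bounded ?F"
    then have "bounded ?H" using HF bounded_subset by blast
    then obtain B where B: "\<And>z. z \<in> ?H \<Longrightarrow> norm z \<le> B" unfolding bounded_iff by blast
    have "w (- (\<bar>B\<bar> + 1)) \<in> ?H" by (simp add: w_def)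
    from B[OF this] show False by (simp add: w_def cmod_def)
  qed
  moreover have "\<phi> ` verts G \<subseteq> frontier ?F"
  proof
    fix z assume "z \<in> \<phi> ` verts G"
    then obtain v where v: "v \<in> verts G" "z = \<phi> v" by blast
    have "z \<in> ?D" using v unfolding drawing_def by blast
    then have "z \<notin> ?F" using connected_component_subset by blast
    then have 1: "z \<notin> interior ?F" using interior_subset by blast
    have "z \<in> closure ?H"
    proof (rule closure_approachable[THEN iffD2], intro allI impI)
      fix \<epsilon> :: real assume "0 < \<epsilon>"
      have "z - Complex 0 (\<epsilon>/2) \<in> ?H" using v \<open>0 < \<epsilon>\<close> by (simp add: \<phi>_def parabola_def)
      moreover have "dist (z - Complex 0 (\<epsilon>/2)) z < \<epsilon>" using \<open>0 < \<epsilon>\<close> by (simp add: dist_norm cmod_def)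
      ultimately show "\<exists>y\<in>?H. dist y z < \<epsilon>" by blast
    qed
    then show "z \<in> frontier ?F" using 1 closure_mono[OF HF] unfolding frontier_def by blast
  qed
  ultimately show ?thesis using emb unfolding outerplanar_def by blast
qed

text \<open>Replaces the isomorphic copy by six named vertices, the form in which \<open>s22\<close>
  speaks of double stars.\<close>

lemma S22_free_iff:
  "graph_free (double_star 2 2) G \<longleftrightarrow> \<not> (\<exists>x y a b c d. distinct [x, y, a, b, c, d] \<and>
     {x, y, a, b, c, d} \<subseteq> verts G \<and>
     {{x, y}, {x, a}, {x, b}, {y, c}, {y, d}} \<subseteq> edges G)" (is "_ \<longleftrightarrow> \<not> ?R")
proof -
  have dse: "edges (double_star 2 2) = {{0, 1}, {0, 2}, {0, 3}, {1, 4}, {1, 5}}"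
  proof -
    have "{2..<2+2::nat} = {2, 3}" "{2+2..<2+2+2::nat} = {4, 5}" by auto
    then show ?thesis by (auto simp: double_star_def)
  qed
  have dsv: "verts (double_star 2 2) = {0, 1, 2, 3, 4, 5}"
    by (auto simp: double_star_def)
  have "(\<exists>K. subgraph K G \<and> isomorphic K (double_star 2 2)) \<longleftrightarrow> ?R"
  proof
    assume "\<exists>K. subgraph K G \<and> isomorphic K (double_star 2 2)"
    then obtain K where K: "subgraph K G" and iso: "isomorphic K (double_star 2 2)" by blast
    note K = K[unfolded subgraph_def, THEN conjunct1] K[unfolded subgraph_def, THEN conjunct2, THEN conjunct1]
      K[unfolded subgraph_def, THEN conjunct2, THEN conjunct2]
    obtain f where f: "bij_betw f (verts K) {0, 1, 2, 3, 4, 5::nat}"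
      and fe: "{{0, 1}, {0, 2}, {0, 3}, {1, 4}, {1, 5}} = (\<lambda>e. f ` e) ` edges K"
      using iso unfolding isomorphic_def dse dsv by (elim exE conjE) (rule that)
    define g where "g = inv_into (verts K) f"
    have gf: "g (f v) = v" if "v \<in> verts K" for v
      using that f by (simp add: g_def bij_betw_def)
    have g: "bij_betw g {0, 1, 2, 3, 4, 5} (verts K)"
      unfolding g_def using f by (rule bij_betw_inv_into)
    have ge: "g ` e \<in> edges G" if "e \<in> {{0, 1}, {0, 2}, {0, 3}, {1, 4}, {1, 5}}" for e
    proof -
      from that have "e \<in> (\<lambda>e. f ` e) ` edges K" unfolding fe .
      then obtain e' where e': "e = f ` e'" "e' \<in> edges K" by (rule imageE)
      have sub: "e' \<subseteq> verts K" using K(1) e'(2) unfolding simple_graph_def by simp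
      have "(\<lambda>v. g (f v)) ` e' = (\<lambda>v. v) ` e'" by (rule image_cong) (use gf sub in auto)
      then have "g ` e = e'" unfolding e'(1) image_image by simp
      then show ?thesis using e'(2) K(3) by auto
    qed
    have "inj_on g {0, 1, 2, 3, 4, 5}" and im: "g ` {0, 1, 2, 3, 4, 5} = verts K"
      using g by (auto simp: bij_betw_def)
    then have "distinct [g 0, g 1, g 2, g 3, g 4, g 5]" by (simp add: inj_on_eq_iff)
    moreover have "{g 0, g 1, g 2, g 3, g 4, g 5} \<subseteq> verts G" using im K(2) by auto
    moreover have "{{g 0, g 1}, {g 0, g 2}, {g 0, g 3}, {g 1, g 4}, {g 1, g 5}} \<subseteq> edges G"
      using ge[of "{0, 1}"] ge[of "{0, 2}"] ge[of "{0, 3}"] ge[of "{1, 4}"] ge[of "{1, 5}"] by simp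
    ultimately show ?R by (intro exI conjI)
  next
    assume ?R
    then obtain x y a b c d where d: "distinct [x, y, a, b, c, d]" "{x, y, a, b, c, d} \<subseteq> verts G"
      "{{x, y}, {x, a}, {x, b}, {y, c}, {y, d}} \<subseteq> edges G" by (elim exE conjE)
    let ?K = "\<lparr>verts = {x, y, a, b, c, d}, edges = {{x, y}, {x, a}, {x, b}, {y, c}, {y, d}}\<rparr>"
    define f :: "'a \<Rightarrow> nat" where "f v = (if v = x then 0 else if v = y then 1 else if v = a then 2
      else if v = b then 3 else if v = c then 4 else 5)" for v
    have fv: "f x = 0" "f y = 1" "f a = 2" "f b = 3" "f c = 4" "f d = 5"
      using d(1) by (auto simp: f_def)
    have "subgraph ?K G" using d by (auto simp: subgraph_def simple_graph_def)
    moreover have "isomorphic ?K (double_star 2 2)"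
      unfolding isomorphic_def dse dsv
      by (intro exI[of _ f]) (simp add: fv bij_betw_def inj_on_def)
    ultimately show "\<exists>K. subgraph K G \<and> isomorphic K (double_star 2 2)" by blast
  qed
  then show ?thesis by (simp add: graph_free_def)
qed

section \<open>Graphs attaining the bound\<close>

text \<open>The friendship (windmill) graph: triangles sharing the vertex 0, with one pendant edge
  left over when \<open>n\<close> is even.\<close>

definition friendship :: "nat \<Rightarrow> nat graph" where
  "friendship n = \<lparr>verts = {..<n},
     edges = (\<lambda>i. {0, i}) ` {1..<n} \<union> (\<lambda>k. {2 * k + 1, 2 * k + 2}) ` {..<(n - 1) div 2}\<rparr>"

lemma friendship_edge:
  assumes "i < j"
  shows "{i, j} \<in> edges (friendship n) \<longleftrightarrow> j < n \<and> (i = 0 \<or> odd i \<and> j = Suc i)"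
proof
  assume "{i, j} \<in> edges (friendship n)"
  then consider m where "1 \<le> m" "m < n" "{i, j} = {0, m}"
    | k where "k < (n - 1) div 2" "{i, j} = {2 * k + 1, 2 * k + 2}"
    unfolding friendship_def by fastforce
  then show "j < n \<and> (i = 0 \<or> odd i \<and> j = Suc i)"
  proof cases
    case 1
    then have "i = 0" "j = m" using assms by (auto simp: doubleton_eq_iff)
    then show ?thesis using 1 by simp
  next
    case 2
    then have "i = 2 * k + 1" "j = 2 * k + 2" using assms by (auto simp: doubleton_eq_iff)
    then show ?thesis using 2 by simp
  qed
next
  assume a: "j < n \<and> (i = 0 \<or> odd i \<and> j = Suc i)"
  have "\<exists>k. i = 2 * k + 1" if "odd i" using that by (rule oddE) blast
  with a consider "i = 0" "j < n" | k where "i = 2 * k + 1" "j = 2 * k + 2" "j < n"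
    by fastforce
  then show "{i, j} \<in> edges (friendship n)"
  proof cases
    case 1
    then have "j \<in> {1..<n}" using assms by simp
    then show ?thesis using 1 unfolding friendship_def by simp
  next
    case 2
    then have "k < (n - 1) div 2" by linarith
    then have "{2 * k + 1, 2 * k + 2} \<in> edges (friendship n)" unfolding friendship_def by simp
    then show ?thesis using 2 by simp
  qed
qed

lemma friendship_pair:
  assumes "e \<in> edges (friendship n)"
  obtains i j where "e = {i, j}" "i < j" "j < n" "i = 0 \<or> odd i \<and> j = Suc i"
proof -
  obtain i j where "e = {i, j}" "i < j" using assms by (auto simp: friendship_def)
  then show ?thesis using that assms friendship_edge by blast
qed

lemma card_edges_friendship: "card (edges (friendship n)) = 3 * (n - 1) div 2"
proof -
  have "card ((\<lambda>i. {0, i}) ` {1..<n}) = n - 1"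
    by (subst card_image) (auto simp: inj_on_def doubleton_eq_iff)
  moreover have "card ((\<lambda>k. {2 * k + 1, 2 * k + 2}) ` {..<(n - 1) div 2}) = (n - 1) div 2"
    by (subst card_image) (auto simp: inj_on_def doubleton_eq_iff)
  moreover have "(\<lambda>i. {0, i}) ` {1..<n} \<inter> (\<lambda>k. {2 * k + 1, 2 * k + 2}) ` {..<(n - 1) div 2} = {}"
  proof (rule equals0I, elim IntE imageE)
    fix e and i k :: nat assume "e = {0, i}" "e = {2 * k + 1, 2 * k + 2}"
    then have "0 \<in> {2 * k + 1, 2 * k + 2}" by blast
    then show False by simp
  qed
  ultimately have "card (edges (friendship n)) = (n - 1) + (n - 1) div 2"
    by (simp add: friendship_def card_Un_disjoint)
  then show ?thesis by simp
qed

lemma friendship_simple: "simple_graph (friendship n)"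
  unfolding simple_graph_def
proof (intro conjI ballI)
  show "finite (verts (friendship n))" by (simp add: friendship_def)
  fix e assume "e \<in> edges (friendship n)"
  then obtain i j where "e = {i, j}" "i < j" "j < n" by (rule friendship_pair)
  then show "e \<subseteq> verts (friendship n)" "card e = 2" by (auto simp: friendship_def)
qed

lemma friendship_outerplanar: "outerplanar (friendship n)"
proof (rule outerplanar_noncrossing)
  fix i j k l assume "{i, j} \<in> edges (friendship n)" "{k, l} \<in> edges (friendship n)" "i < k" "k < j" "j < l"
  then show False by (auto simp: friendship_edge)
qed (use friendship_simple in \<open>auto simp: simple_graph_def\<close>)

text \<open>Both centres of a double star have degree at least 3, but only the vertex 0 has such a
  degree here.\<close>

lemma friendship_S22_free: "graph_free (double_star 2 2) (friendship n)"
  unfolding S22_free_iff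
proof clarify
  fix x y a b c d :: nat
  assume d: "distinct [x, y, a, b, c, d]"
    and e: "{{x, y}, {x, a}, {x, b}, {y, c}, {y, d}} \<subseteq> edges (friendship n)"
  have deg: False if "v \<noteq> 0" "distinct [v, p, q, r]" "{v, p} \<in> edges (friendship n)" "{v, q} \<in> edges (friendship n)"
    "{v, r} \<in> edges (friendship n)" for v p q r
  proof -
    \<comment> \<open>Triangles pair an odd number with its successor, so a vertex other than 0 has
      at most one neighbour besides 0.\<close>
    have "t = 0 \<or> t = (if odd v then Suc v else v - 1)" if t: "{v, t} \<in> edges (friendship n)" "t \<noteq> v" for t
    proof (cases "v < t")
      case True
      then show ?thesis using friendship_edge[OF True] t \<open>v \<noteq> 0\<close> by auto
    next
      case False
      then have "t < v" using t by simp
      then show ?thesis using friendship_edge[of t v n] t by (auto simp: insert_commute)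
    qed
    from this[of p] this[of q] this[of r] that show False by auto
  qed
  show False
  proof (cases "x = 0")
    case True
    then show False using deg[of y x c d] d e by (auto simp: insert_commute)
  next
    case False
    then show False using deg[of x y a b] d e by auto
  qed
qed

text \<open>The hubs are 0 and 5. Each hub is numbered before its path and the path in order, so no
  two edges interleave.\<close>

definition two_fans :: "nat graph" where
  "two_fans = \<lparr>verts = {..<10},
     edges = {{0, 1}, {0, 2}, {0, 3}, {0, 4}, {1, 2}, {2, 3}, {3, 4},
       {5, 6}, {5, 7}, {5, 8}, {5, 9}, {6, 7}, {7, 8}, {8, 9}}\<rparr>"

lemma card_edges_two_fans: "card (edges two_fans) = 14"
  by (simp add: two_fans_def doubleton_eq_iff)

lemma two_fans_simple: "simple_graph two_fans"
  by (simp add: simple_graph_def two_fans_def)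

lemma two_fans_outerplanar: "outerplanar two_fans"
proof (rule outerplanar_noncrossing)
  fix i j k l assume e: "{i, j} \<in> edges two_fans" "{k, l} \<in> edges two_fans" and o: "i < k" "k < j" "j < l"
  have *: "p = 0 \<and> q < 5 \<or> p = 5 \<or> q = Suc p" if "{p, q} \<in> edges two_fans" "p < q" for p q
    using that by (auto simp: two_fans_def doubleton_eq_iff)
  show False using *[OF e(1)] *[OF e(2)] o by auto
qed (use two_fans_simple in \<open>auto simp: simple_graph_def\<close>)

text \<open>Each component has only five vertices, whereas the double star has six.\<close>

lemma two_fans_S22_free: "graph_free (double_star 2 2) two_fans"
  unfolding S22_free_iff
proof clarify
  fix x y a b c d :: nat
  assume d: "distinct [x, y, a, b, c, d]" and V: "{x, y, a, b, c, d} \<subseteq> verts two_fans"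
    and e: "{{x, y}, {x, a}, {x, b}, {y, c}, {y, d}} \<subseteq> edges two_fans"
  have side: "p < 5 \<longleftrightarrow> q < 5" if "{p, q} \<in> edges two_fans" for p q
    using that by (auto simp: two_fans_def doubleton_eq_iff)
  have s: "y < 5 \<longleftrightarrow> x < 5" "a < 5 \<longleftrightarrow> x < 5" "b < 5 \<longleftrightarrow> x < 5" "c < 5 \<longleftrightarrow> x < 5" "d < 5 \<longleftrightarrow> x < 5"
    using side[of x y] side[of x a] side[of x b] side[of y c] side[of y d] e by auto
  have c6: "card {x, y, a, b, c, d} = 6" using d by simp
  show False
  proof (cases "x < 5")
    case True
    then have "{x, y, a, b, c, d} \<subseteq> {..<5}" using s by auto
    from card_mono[OF _ this] c6 show False by simp
  next
    case False
    then have "{x, y, a, b, c, d} \<subseteq> {5..<10}" using s V by (auto simp: two_fans_def)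
    from card_mono[OF _ this] c6 show False by simp
  qed
qed

section \<open>The extremal number\<close>

lemma outerplanar_sparse:
  assumes "simple_graph G" "outerplanar G" "graph_free (double_star 2 2) G"
  shows "sparse (verts G) (edges G)"
proof -
  obtain \<phi> \<gamma> F where F: "planar_embedding G \<phi> \<gamma>" "F \<in> components (- drawing G \<phi> \<gamma>)" "\<not> bounded F"
    "\<phi> ` verts G \<subseteq> frontier F"
    using assms(2) unfolding outerplanar_def by blast
  have ed: "e \<subseteq> verts G \<and> card e = 2" if "e \<in> edges G" for e
    using assms(1) that by (auto simp: simple_graph_def)
  interpret outer_drawing G \<phi> \<gamma> F
    by unfold_locales (use F ed in auto)
  show ?thesis
  proof
    show "finite (verts G)" using assms(1) by (simp add: simple_graph_def)
    show False if "{x, y} \<in> edges G" "{x, a} \<in> edges G" "{x, b} \<in> edges G" "{y, c} \<in> edges G"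
      "{y, d} \<in> edges G" "distinct [x, y, a, b, c, d]" for x y a b c d
    proof -
      have "{x, y, a, b, c, d} \<subseteq> verts G"
        using ed[OF that(1)] ed[OF that(2)] ed[OF that(3)] ed[OF that(4)] ed[OF that(5)] by simp
      moreover have "{{x, y}, {x, a}, {x, b}, {y, c}, {y, d}} \<subseteq> edges G" using that by simp
      ultimately have "\<exists>x y a b c d. distinct [x, y, a, b, c, d] \<and> {x, y, a, b, c, d} \<subseteq> verts G \<and>
        {{x, y}, {x, a}, {x, b}, {y, c}, {y, d}} \<subseteq> edges G"
        using that(6) by (intro exI conjI)
      then show False using assms(3) unfolding S22_free_iff by contradiction
    qed
    show "e \<subseteq> verts G \<and> card e = 2" if "e \<in> edges G" for e using ed[OF that] .
    show False if "kite (edges G) x y a b" "{a, b} \<in> edges G" for x y a b using no_K4[OF that] .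
    show "\<not> fat_theta (edges G) x y P Q R" for x y P Q R by (rule no_fat_theta)
  qed
qed

theorem theorem3:
  fixes n :: nat
  assumes "n \<ge> 6"
  shows "ex_outerplanar n (double_star 2 2) =
           (if n \<noteq> 10 then (3 * (n - 1)) div 2 else 14)"
proof -
  let ?m = "if n \<noteq> 10 then (3 * (n - 1)) div 2 else 14"
  let ?S = "{card (edges G) | G :: nat graph.
    simple_graph G \<and> card (verts G) = n \<and> outerplanar G \<and> graph_free (double_star 2 2) G}"
  have upper: "m \<le> ?m" if "m \<in> ?S" for m
  proof -
    obtain G :: "nat graph" where G: "m = card (edges G)" "simple_graph G" "card (verts G) = n"
      "outerplanar G" "graph_free (double_star 2 2) G"
      using \<open>m \<in> ?S\<close> by blast
    have "verts G \<noteq> {}" using G(3) assms by auto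
    from edge_bound[OF outerplanar_sparse[OF G(2,4,5)] this]
    \<comment> \<open>As \<open>n\<close> is at least 6, the exceptions on 4 and 5 vertices drop
      out. For \<open>n = 10\<close> the first alternative gives only 13, so 14 covers both.\<close>
    have "2 * m + 3 \<le> 3 * n \<or> n = 10 \<and> m \<le> 14" using G(1,3) assms by auto
    then show ?thesis by auto
  qed
  have "?m \<in> ?S"
  proof (cases "n = 10")
    case True
    have "simple_graph two_fans \<and> card (verts two_fans) = n \<and> outerplanar two_fans \<and>
        graph_free (double_star 2 2) two_fans"
      using True two_fans_simple two_fans_outerplanar two_fans_S22_free by (simp add: two_fans_def)
    moreover have "?m = card (edges two_fans)" using True by (simp add: card_edges_two_fans)
    ultimately show ?thesis by blast
  next
    case False
    have "simple_graph (friendship n) \<and> card (verts (friendship n)) = n \<and> outerplanar (friendship n) \<and>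
        graph_free (double_star 2 2) (friendship n)"
      using friendship_simple friendship_outerplanar friendship_S22_free by (simp add: friendship_def)
    moreover have "?m = card (edges (friendship n))" using False by (simp add: card_edges_friendship)
    ultimately show ?thesis by blast
  qed
  moreover have "finite ?S"
  proof (rule finite_subset)
    show "?S \<subseteq> {..?m}"
    proof
      fix m assume "m \<in> ?S"
      then show "m \<in> {..?m}" unfolding atMost_iff by (rule upper)
    qed
  qed simp
  ultimately show ?thesis unfolding ex_outerplanar_def using upper by (intro Max_eqI)
qed

end
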